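(* In the random-intercept setting of the context with $K=2$, assume the balancedness condition: for $k=1,2$, $n^{(k)}_g=n^{(k)}_{g'}>0$ for all $g,g'\in\{1,\dots,G_k\}$. Let $q^*_{PF}=\arg\max_qV(q\Vert\pi)$ over the family $\{q:q(\theta)=q(\theta_0\mid\theta_1,\theta_2)\,q(\theta_1)\,q(\theta_2)\}$. Then $$UQF(q^*_{PF}\Vert\pi)=1-\Big(\prod_{k=1}^2\Big[\frac{n\bar{D}}{G_kT_k+n\bar{D}}\Big]^{1/2}\Big)\lambda_{aux}^{1/2},$$ where $\bar D=\frac1n\sum_iD_{ii}^2$ and $\lambda_{aux}$ is the second largest modulus eigenvalue of the $G_1\times G_1$ stochastic matrix $S_{12}S_{21}$; here $S_{k\ell}$ ($k\ne\ell$) is the $G_k\times G_\ell$ matrix with $(g,h)$ entry $n^{(k,\ell)}_{g,h}/n^{(k)}_g$, and "second largest modulus eigenvalue" means $|\lambda_2|$ when the eigenvalues (with multiplicity) are ordered as $|\lambda_1|\ge|\lambda_2|\ge\dots$ with $\lambda_1=1$.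
   Context: Random-intercept setting: integers $n,K\ge1$, $G_1,\dots,G_K\ge1$; each observation $i=1,\dots,n$ belongs to exactly one level of each factor $k$, encoded by a one-hot vector $m_{i,k}=(m_{i,k,1},\dots,m_{i,k,G_k})\in\{0,1\}^{G_k}$. Parameters $\theta=(\theta_0,\theta_1,\dots,\theta_K)$ with $\theta_0\in\mathbb{R}$, $\theta_k\in\mathbb{R}^{G_k}$, and $\eta_i(\theta)=\theta_0+\sum_{k=1}^Km_{i,k}^T\theta_k$. Given constants $D_{ii}>0$, $T_k>0$ and $\nu\in\mathbb{R}^n$, the target is the Gaussian distribution $\pi(\theta)\propto\exp\{-\frac12\sum_{i=1}^n(\nu_i-D_{ii}\eta_i(\theta))^2-\frac12\sum_{k=1}^KT_k\|\theta_k\|^2\}$ (in the paper, the intermediate target of a Gaussian or Polya-Gamma-augmented binomial random-intercept mixed model with flat prior on $\theta_0$ and fixed variational factor $q(\phi)$). Weighted counts: $n^{(k,\ell)}_{g,h}=\sum_{i=1}^nD_{ii}^2m_{i,k,g}m_{i,\ell,h}$ and $n^{(k)}_g=n^{(k,k)}_{g,g}$. $V(q\Vert\pi)=\mathbb{E}_q[\log\pi-\log q]$; $UQF(q\Vert\pi)=\inf_{v\ne0}\mathrm{var}_q(\theta^Tv)/\mathrm{var}_\pi(\theta^Tv)$. *)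

theory Defs
  imports "HOL-Analysis.Analysis" "HOL-Computational_Algebra.Polynomial" "HOL-Library.Multiset"
begin

text \<open>Parameter space: theta = (theta0, theta1, theta2) with theta0 real,
  theta1 in R^G1 (indexed by the finite type 'g1), theta2 in R^G2 (indexed by 'g2).
  Observations are indexed by a finite type 'i (n = CARD('i)); the one-hot vector
  m_{i,k} is encoded by the level function lk :: 'i => 'gk.\<close>

type_synonym ('g1, 'g2) par = "real \<times> (real^'g1) \<times> (real^'g2)"

definition eta :: "('i \<Rightarrow> 'g1::finite) \<Rightarrow> ('i \<Rightarrow> 'g2::finite) \<Rightarrow> ('g1,'g2) par \<Rightarrow> 'i \<Rightarrow> real" where
  "eta l1 l2 \<theta> i = fst \<theta> + (fst (snd \<theta>)) $ (l1 i) + (snd (snd \<theta>)) $ (l2 i)"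

text \<open>Minus twice the log of the unnormalised target density.\<close>
definition energy :: "('i::finite \<Rightarrow> real) \<Rightarrow> ('i \<Rightarrow> real) \<Rightarrow> real \<Rightarrow> real \<Rightarrow>
    ('i \<Rightarrow> 'g1::finite) \<Rightarrow> ('i \<Rightarrow> 'g2::finite) \<Rightarrow> ('g1,'g2) par \<Rightarrow> real" where
  "energy D \<nu> T1 T2 l1 l2 \<theta> =
     (\<Sum>i\<in>UNIV. (\<nu> i - D i * eta l1 l2 \<theta> i)^2)
     + T1 * (norm (fst (snd \<theta>)))^2 + T2 * (norm (snd (snd \<theta>)))^2"

definition pi_dens :: "('i::finite \<Rightarrow> real) \<Rightarrow> ('i \<Rightarrow> real) \<Rightarrow> real \<Rightarrow> real \<Rightarrow>
    ('i \<Rightarrow> 'g1::finite) \<Rightarrow> ('i \<Rightarrow> 'g2::finite) \<Rightarrow> ('g1,'g2) par \<Rightarrow> real" where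
  "pi_dens D \<nu> T1 T2 l1 l2 \<theta> =
     exp (- energy D \<nu> T1 T2 l1 l2 \<theta> / 2)
     / integral\<^sup>L lborel (\<lambda>\<theta>'. exp (- energy D \<nu> T1 T2 l1 l2 \<theta>' / 2))"

definition pf_family :: "(('g1::finite, 'g2::finite) par \<Rightarrow> real) \<Rightarrow> bool" where
  "pf_family f \<longleftrightarrow>
     f \<in> borel_measurable borel \<and> (\<forall>\<theta>. 0 \<le> f \<theta>) \<and> integrable lborel f \<and> integral\<^sup>L lborel f = 1 \<and>
     (\<exists>(c :: real \<Rightarrow> real^'g1 \<Rightarrow> real^'g2 \<Rightarrow> real) (a :: real^'g1 \<Rightarrow> real) (b :: real^'g2 \<Rightarrow> real).
        (\<forall>t x y. 0 \<le> c t x y) \<and> (\<forall>x. 0 \<le> a x) \<and> (\<forall>y. 0 \<le> b y) \<and>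
        (\<forall>x y. integrable lborel (\<lambda>t. c t x y) \<and> integral\<^sup>L lborel (\<lambda>t. c t x y) = 1) \<and>
        integrable lborel a \<and> integral\<^sup>L lborel a = 1 \<and>
        integrable lborel b \<and> integral\<^sup>L lborel b = 1 \<and>
        (\<forall>t x y. f (t, x, y) = c t x y * a x * b y))"

text \<open>The integrand of V(q || pi) = E_q[log pi - log q] (with 0 log 0 = 0).\<close>
definition V_integrand :: "(('g1::finite, 'g2::finite) par \<Rightarrow> real) \<Rightarrow> (('g1,'g2) par \<Rightarrow> real)
    \<Rightarrow> ('g1,'g2) par \<Rightarrow> real" where
  "V_integrand p f \<theta> = f \<theta> * (ln (p \<theta>) - ln (f \<theta>))"

definition Vobj :: "(('g1::finite, 'g2::finite) par \<Rightarrow> real) \<Rightarrow> (('g1,'g2) par \<Rightarrow> real) \<Rightarrow> real" where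
  "Vobj p f = integral\<^sup>L lborel (V_integrand p f)"

text \<open>f is a maximiser of V(. || pi) over the partially factorized family.
  (Members with V = -infinity, i.e. non-integrable integrand, can never be maximisers.)\<close>
definition is_pf_opt :: "(('g1::finite, 'g2::finite) par \<Rightarrow> real) \<Rightarrow> (('g1,'g2) par \<Rightarrow> real) \<Rightarrow> bool" where
  "is_pf_opt p f \<longleftrightarrow> pf_family f \<and> integrable lborel (V_integrand p f) \<and>
     (\<forall>g. pf_family g \<and> integrable lborel (V_integrand p g) \<longrightarrow> Vobj p g \<le> Vobj p f)"

definition dvar :: "(('a::euclidean_space) \<Rightarrow> real) \<Rightarrow> ('a \<Rightarrow> real) \<Rightarrow> real" where
  "dvar f X = integral\<^sup>L lborel (\<lambda>\<theta>. f \<theta> * (X \<theta> - integral\<^sup>L lborel (\<lambda>\<theta>'. f \<theta>' * X \<theta>'))^2)"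

definition UQF :: "(('a::euclidean_space) \<Rightarrow> real) \<Rightarrow> ('a \<Rightarrow> real) \<Rightarrow> real" where
  "UQF f p = Inf {dvar f (\<lambda>\<theta>. \<theta> \<bullet> v) / dvar p (\<lambda>\<theta>. \<theta> \<bullet> v) | v. v \<noteq> 0}"

definition wcnt :: "('i::finite \<Rightarrow> real) \<Rightarrow> ('i \<Rightarrow> 'a) \<Rightarrow> ('i \<Rightarrow> 'b) \<Rightarrow> 'a \<Rightarrow> 'b \<Rightarrow> real" where
  "wcnt D lk ll g h = (\<Sum>i\<in>UNIV. (D i)^2 * (if lk i = g \<and> ll i = h then 1 else 0))"

definition Smat :: "('i::finite \<Rightarrow> real) \<Rightarrow> ('i \<Rightarrow> 'a::finite) \<Rightarrow> ('i \<Rightarrow> 'b::finite) \<Rightarrow> real^'b^'a" where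
  "Smat D lk ll = (\<chi> g h. wcnt D lk ll g h / wcnt D lk lk g g)"

definition charpoly :: "real^'n^'n \<Rightarrow> complex poly" where
  "charpoly A = det (\<chi> i j. (if i = j then [:0, 1:] else 0) - [:complex_of_real (A $ i $ j):])"

text \<open>Second largest modulus among the eigenvalues (with multiplicity);
  0 if the matrix has fewer than two eigenvalues (1x1 case).\<close>
definition second_mod_eig :: "real^'n^'n \<Rightarrow> real" where
  "second_mod_eig A =
     (let L = rev (sorted_list_of_multiset (image_mset cmod (proots (charpoly A))))
      in if length L < 2 then 0 else L ! 1)"

end

theory Submission
  imports Defs "HOL-Probability.Distributions"
begin

text \<open>
  Let \<open>Q\<close> be the precision operator of the Gaussian target with mean \<open>\<mu>\<close>, and \<open>R\<close> the operator obtained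
  from it by deleting the term \<open>2 x \<bullet> B y\<close> that couples the two blocks once \<open>\<theta>\<^sub>0\<close> is integrated out.
  For a member \<open>f\<close> of the family with mean \<open>m\<close>, comparing \<open>f\<close> with the Gaussian of mean \<open>m\<close> and
  precision \<open>R\<close> and using that the blocks are independent under \<open>f\<close> shows that the objective falls
  short of a constant by a relative entropy plus \<open>(m - \<mu>) \<bullet> Q (m - \<mu>) / 2\<close>. So the optimum is the
  Gaussian with mean \<open>\<mu>\<close> and precision \<open>R\<close>, unique almost everywhere. By duality the ratio of variances is
  bounded below by the smallest generalised eigenvalue of \<open>Q\<close> with respect to \<open>R\<close>. Under
  balancedness this is one minus a correlation that is governed by the weighted count matrix
  restricted to the orthogonal complement of the constant vector, which is where the second
  eigenvalue of \<open>S\<^sub>1\<^sub>2 S\<^sub>2\<^sub>1\<close> enters.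
\<close>

section \<open>Gaussian densities on Euclidean spaces\<close>

lemma lborel_integral_uminus:
  fixes f :: "'a::euclidean_space \<Rightarrow> real"
  assumes [measurable]: "f \<in> borel_measurable borel"
  shows "(\<integral>x. f (- x) \<partial>lborel) = (\<integral>x. f x \<partial>lborel)"
proof -
  have "(lborel :: 'a measure) = distr lborel borel uminus"
    using lborel_affine[of "-1" "0::'a"] by (simp add: density_1)
  then have "(\<integral>x. f x \<partial>lborel) = (\<integral>x. f x \<partial>(distr lborel borel uminus))"
    by simp
  also have "\<dots> = (\<integral>x. f (- x) \<partial>lborel)"
    by (rule integral_distr) auto
  finally show ?thesis ..
qed

lemma lborel_integral_shift:
  fixes f :: "'a::euclidean_space \<Rightarrow> real"
  assumes [measurable]: "f \<in> borel_measurable borel"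
  shows "(\<integral>x. f (x - c) \<partial>lborel) = (\<integral>x. f x \<partial>lborel)"
proof -
  have "(\<integral>x. f x \<partial>lborel) = (\<integral>x. f x \<partial>(distr lborel borel ((+) (- c))))"
    by (simp add: lborel_distr_plus)
  also have "\<dots> = (\<integral>x. f (x - c) \<partial>lborel)"
    by (subst integral_distr) auto
  finally show ?thesis ..
qed

lemma lborel_integrable_shift:
  fixes f :: "'a::euclidean_space \<Rightarrow> real"
  assumes "integrable lborel f"
  shows "integrable lborel (\<lambda>x. f (x - c))"
proof -
  have "integrable (distr lborel borel ((+) (- c))) f"
    using assms by (simp add: lborel_distr_plus)
  then have "integrable lborel (\<lambda>x. f (- c + x))"
    by (rule integrable_distr[rotated]) auto
  then show ?thesis by simp
qed

text \<open>Each coordinate contributes a multiple of a normal density, and the nonnegative integral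
  factorises over \<open>Basis\<close>.\<close>

lemma integrable_exp_norm_square:
  assumes "c > 0"
  shows "integrable lborel (\<lambda>x::'a::euclidean_space. exp (- c * (norm x)\<^sup>2))"
proof -
  have one: "integrable lborel (\<lambda>x::real. exp (- c * x\<^sup>2))"
  proof -
    \<comment> \<open>With variance \<open>1 / (2 * c)\<close> the exponent of the normal density is
      \<open>- c * x\<^sup>2\<close>.\<close>
    define s where "s = sqrt (1 / (2 * c))"
    have s: "s > 0" "s\<^sup>2 = 1 / (2 * c)" using assms by (auto simp: s_def)
    have "integrable lborel (\<lambda>x. sqrt (2 * pi * s\<^sup>2) * normal_density 0 s x)"
      by (intro integrable_mult_right integrable_normal_density s)
    moreover have "sqrt (2 * pi * s\<^sup>2) * normal_density 0 s x = exp (- c * x\<^sup>2)" for x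
      using s assms by (simp add: normal_density_def field_simps)
    ultimately show ?thesis by simp
  qed
  have prod: "exp (- c * (norm x)\<^sup>2) = (\<Prod>b\<in>Basis. exp (- c * (x \<bullet> b)\<^sup>2))" for x :: 'a
  proof -
    have "(norm x)\<^sup>2 = (\<Sum>b\<in>Basis. (x \<bullet> b)\<^sup>2)"
      unfolding power2_norm_eq_inner using euclidean_inner[of x x] by (simp add: power2_eq_square)
    then show ?thesis by (simp add: exp_sum sum_distrib_left)
  qed
  show ?thesis
  proof (rule integrableI_nonneg)
    have "(\<integral>\<^sup>+(x::'a). ennreal (exp (- c * (norm x)\<^sup>2)) \<partial>lborel)
        = (\<integral>\<^sup>+(x::'a). (\<Prod>b\<in>Basis. ennreal (exp (- c * (x \<bullet> b)\<^sup>2))) \<partial>lborel)"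
      unfolding prod by (subst prod_ennreal) auto
    also have "\<dots> = (\<Prod>b\<in>(Basis::'a set). \<integral>\<^sup>+x. ennreal (exp (- c * x\<^sup>2)) \<partial>lborel)"
      by (rule nn_integral_lborel_prod) auto
    also have "\<dots> < \<infinity>"
      using integrableD(2)[OF one]
      by (simp add: power_less_top_ennreal less_top)
    finally show "(\<integral>\<^sup>+(x::'a). ennreal (exp (- c * (norm x)\<^sup>2)) \<partial>lborel) < \<infinity>" .
  qed auto
qed

section \<open>Hyperbolic cosine estimates for second moments\<close>

lemma cosh_double_sinh: "cosh (2 * x) = 2 * (sinh x)\<^sup>2 + (1::real)"
  using cosh_double_cosh[of x] cosh_square_eq[of x] by simp

text \<open>The half-angle identity reduces this to \<open>sinh y \<ge> y\<close> for
  \<open>y \<ge> 0\<close>. It lets a cosh moment dominate a second moment.\<close>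

lemma cosh_minus_one_ge: "(x::real)\<^sup>2 / 2 \<le> cosh x - 1"
proof -
  have "sinh (x/2) ^ 2 \<ge> (x/2)\<^sup>2"
  proof -
    have *: "sinh y \<ge> y" if "y \<ge> 0" for y :: real
    proof -
      have "(\<lambda>y. sinh y - y) 0 \<le> (\<lambda>y. sinh y - y) y"
        by (rule DERIV_nonneg_imp_nondecreasing[OF that])
           (auto intro!: exI derivative_eq_intros cosh_real_ge_1)
      then show ?thesis by simp
    qed
    have "\<bar>x/2\<bar> \<le> sinh \<bar>x/2\<bar>" by (rule *) simp
    then have "\<bar>x/2\<bar>^2 \<le> (sinh \<bar>x/2\<bar>)^2" by (intro power_mono) auto
    then show ?thesis by (cases "x \<ge> 0") (auto simp: abs_if)
  qed
  moreover have "cosh x = 2 * sinh (x/2)^2 + 1"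
    using cosh_double_sinh[of "x/2"] by simp
  ultimately show ?thesis by (simp add: power_divide)
qed

text \<open>By the half-angle identity it suffices that \<open>sinh (s * y) \<le> s * sinh y\<close>
  for \<open>y \<ge> 0\<close>, which follows by comparing derivatives. After division by
  \<open>s\<^sup>2\<close> the bound does not depend on the scale, as dominated convergence
  requires.\<close>

lemma cosh_scaled_le:
  assumes "0 \<le> s" "s \<le> 1"
  shows "cosh (s * x) - 1 \<le> s\<^sup>2 * (cosh x - (1::real))"
proof -
  have *: "sinh (s * y) \<le> s * sinh y" if "y \<ge> 0" for y :: real
  proof -
    have "(\<lambda>y. s * sinh y - sinh (s * y)) 0 \<le> (\<lambda>y. s * sinh y - sinh (s * y)) y"
    proof (rule DERIV_nonneg_imp_nondecreasing[OF that])
      fix z assume z: "0 \<le> (z::real)"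
      have "cosh (s * z) \<le> cosh z"
        using assms z by (intro cosh_real_nonneg_le_iff[THEN iffD2]) (auto simp: mult_left_le_one_le)
      then have "0 \<le> cosh z * s - cosh (s * z) * s"
        using assms by (simp add: mult_right_mono)
      then show "\<exists>y. ((\<lambda>y. s * sinh y - sinh (s * y)) has_real_derivative y) (at z) \<and> 0 \<le> y"
        by (intro exI conjI) (auto intro!: derivative_eq_intros)
    qed
    then show ?thesis by simp
  qed
  have "sinh (s * \<bar>x/2\<bar>) ^ 2 \<le> (s * sinh \<bar>x/2\<bar>) ^ 2"
    using *[of "\<bar>x/2\<bar>"] assms by (intro power_mono) auto
  then have "sinh (s * (x/2)) ^ 2 \<le> s\<^sup>2 * sinh (x/2) ^ 2"
    by (cases "x \<ge> 0") (auto simp: abs_if power_mult_distrib)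
  moreover have "cosh x = 2 * sinh (x/2)^2 + 1"
    using cosh_double_sinh[of "x/2"] by simp
  moreover have "cosh (s * x) = 2 * sinh (s * (x/2))^2 + 1"
    using cosh_double_sinh[of "s * (x/2)"] by simp
  ultimately show ?thesis by (simp add: algebra_simps)
qed

section \<open>Gaussian densities with a given precision operator\<close>

text \<open>\<open>Q\<close> is the precision, not the covariance, and the normaliser is kept as an
  integral rather than as a determinant.\<close>

definition gauss :: "('a::euclidean_space \<Rightarrow> 'a) \<Rightarrow> 'a \<Rightarrow> 'a \<Rightarrow> real" where
  "gauss Q \<mu> \<theta> = exp (- ((\<theta> - \<mu>) \<bullet> Q (\<theta> - \<mu>)) / 2) / (\<integral>\<theta>. exp (- (\<theta> \<bullet> Q \<theta>) / 2) \<partial>lborel)"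

locale spd =
  fixes Q :: "'a::euclidean_space \<Rightarrow> 'a"
  assumes lin: "linear Q"
    and sym: "Q x \<bullet> y = x \<bullet> Q y"
    and pos: "x \<noteq> 0 \<Longrightarrow> 0 < x \<bullet> Q x"
begin

lemma nonneg: "0 \<le> x \<bullet> Q x"
  using pos[of x] linear_0[OF lin] by (cases "x = 0") auto

lemma measurable_Q [measurable]: "Q \<in> borel_measurable borel"
  by (intro borel_measurable_continuous_onI linear_continuous_on linear_conv_bounded_linear[THEN iffD1] lin)

text \<open>The quadratic form attains a positive minimum on the compact unit sphere; homogeneity
  carries the bound to all vectors.\<close>

lemma coercive: obtains c where "c > 0" "\<And>x. c * (norm x)\<^sup>2 \<le> x \<bullet> Q x"
proof -
  have cont: "continuous_on (sphere 0 1) (\<lambda>x. x \<bullet> Q x)"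
    by (intro continuous_intros linear_continuous_on linear_conv_bounded_linear[THEN iffD1] lin)
  obtain b :: 'a where "b \<in> Basis" using nonempty_Basis by blast
  then have "sphere 0 1 \<noteq> ({} :: 'a set)" by (auto simp: sphere_def dist_norm intro!: exI[of _ b])
  then obtain u :: 'a where u: "u \<in> sphere 0 1" "\<And>x. x \<in> sphere 0 1 \<Longrightarrow> u \<bullet> Q u \<le> x \<bullet> Q x"
    using continuous_attains_inf[OF compact_sphere _ cont] by blast
  show thesis
  proof
    show "u \<bullet> Q u > 0" using u(1) by (intro pos) auto
    fix x :: 'a
    show "u \<bullet> Q u * (norm x)\<^sup>2 \<le> x \<bullet> Q x"
    proof (cases "x = 0")
      case False
      have "u \<bullet> Q u \<le> (x /\<^sub>R norm x) \<bullet> Q (x /\<^sub>R norm x)"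
        using False by (intro u(2)) auto
      also have "\<dots> = x \<bullet> Q x / (norm x)\<^sup>2"
        by (simp add: linear_cmul[OF lin] power2_eq_square field_simps)
      finally show ?thesis using False by (simp add: field_simps)
    qed (simp add: nonneg)
  qed
qed

lemma surjE: obtains w where "Q w = v"
proof -
  have "inj Q"
    unfolding linear_injective_0[OF lin] using pos by (metis inner_zero_right less_irrefl)
  then have "surj Q" using linear_injective_imp_surjective[OF lin] by simp
  then show thesis using that by (metis surj_def)
qed

lemma form_diff: "(x - y) \<bullet> Q (x - y) = x \<bullet> Q x - 2 * (x \<bullet> Q y) + y \<bullet> Q y"
  using sym[of x y] by (simp add: linear_diff[OF lin] inner_diff inner_commute algebra_simps)

lemma integrable_exp_form: "integrable lborel (\<lambda>\<theta>. exp (- (\<theta> \<bullet> Q \<theta>) / 2))"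
proof -
  obtain c where c: "c > 0" "\<And>x. c * (norm x)\<^sup>2 \<le> x \<bullet> Q x" using coercive by blast
  show ?thesis
  proof (rule Bochner_Integration.integrable_bound[OF integrable_exp_norm_square[of "c/2"]])
    show "AE x in lborel. norm (exp (- (x \<bullet> Q x) / 2)) \<le> norm (exp (- (c / 2) * (norm x)\<^sup>2))"
      using c(2) by (intro AE_I2) simp
  qed (use c in auto)
qed

lemma normaliser_pos: "0 < (\<integral>\<theta>. exp (- (\<theta> \<bullet> Q \<theta>) / 2) \<partial>lborel)"
proof -
  have "(\<integral>\<theta>. exp (- (\<theta> \<bullet> Q \<theta>) / 2) \<partial>lborel) \<noteq> 0"
  proof
    assume "(\<integral>\<theta>. exp (- (\<theta> \<bullet> Q \<theta>) / 2) \<partial>lborel) = 0"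
    then have "AE \<theta> in lborel. exp (- (\<theta> \<bullet> Q \<theta>) / 2) = 0"
      by (subst (asm) integral_nonneg_eq_0_iff_AE) (use integrable_exp_form in auto)
    then have "AE \<theta> in (lborel :: 'a measure). False" by simp
    then have "emeasure (lborel :: 'a measure) UNIV = 0"
      by (simp add: AE_iff_null null_sets_def)
    then show False by simp
  qed
  moreover have "0 \<le> (\<integral>\<theta>. exp (- (\<theta> \<bullet> Q \<theta>) / 2) \<partial>lborel)" by simp
  ultimately show ?thesis by linarith
qed

lemma gauss_pos: "0 < gauss Q \<mu> \<theta>"
  unfolding gauss_def using normaliser_pos by simp

lemma measurable_gauss [measurable]: "gauss Q \<mu> \<in> borel_measurable borel"
  unfolding gauss_def by measurable

lemma gauss_shift: "gauss Q \<mu> \<theta> = gauss Q 0 (\<theta> - \<mu>)"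
  by (simp add: gauss_def)

lemma integrable_gauss: "integrable lborel (gauss Q \<mu>)"
proof -
  have "integrable lborel (gauss Q 0)"
    unfolding gauss_def using integrable_exp_form by simp
  from lborel_integrable_shift[OF this, of \<mu>] show ?thesis
    by (subst gauss_shift[abs_def])
qed

lemma integral_gauss: "(\<integral>\<theta>. gauss Q \<mu> \<theta> \<partial>lborel) = 1"
proof -
  have "(\<integral>\<theta>. gauss Q \<mu> \<theta> \<partial>lborel) = (\<integral>\<theta>. gauss Q 0 \<theta> \<partial>lborel)"
    unfolding gauss_shift[of \<mu>] by (rule lborel_integral_shift) simp
  also have "\<dots> = 1" unfolding gauss_def using normaliser_pos by simp
  finally show ?thesis .
qed

text \<open>Completing the square: tilting a centred Gaussian by a linear functional translates it.\<close>

lemma gauss_tilt: "Q w = v \<Longrightarrow> gauss Q 0 \<theta> * exp (\<theta> \<bullet> v) = exp (w \<bullet> v / 2) * gauss Q w \<theta>"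
  by (simp add: gauss_def form_diff flip: exp_add) (simp add: field_simps)

text \<open>Write cosh as the mean of two exponentials: each one translates the Gaussian, to
  \<open>s *\<^sub>R w\<close> and to its negative, and the translates have mass one.\<close>

lemma cosh_moment:
  assumes "Q w = v"
  shows "integrable lborel (\<lambda>\<theta>. gauss Q 0 \<theta> * (cosh (s * (\<theta> \<bullet> v)) - 1))"
    and "(\<integral>\<theta>. gauss Q 0 \<theta> * (cosh (s * (\<theta> \<bullet> v)) - 1) \<partial>lborel) = exp (s\<^sup>2 * (w \<bullet> v) / 2) - 1"
proof -
  have Q: "Q (s *\<^sub>R w) = s *\<^sub>R v" "Q ((-s) *\<^sub>R w) = (-s) *\<^sub>R v"
    using assms by (simp_all add: linear_cmul[OF lin] linear_neg[OF lin])
  have eq: "gauss Q 0 \<theta> * (cosh (s * (\<theta> \<bullet> v)) - 1) =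
     exp (s\<^sup>2 * (w \<bullet> v) / 2) / 2 * (gauss Q (s *\<^sub>R w) \<theta> + gauss Q ((-s) *\<^sub>R w) \<theta>) - gauss Q 0 \<theta>" for \<theta>
    using gauss_tilt[OF Q(1), of \<theta>] gauss_tilt[OF Q(2), of \<theta>]
    by (simp add: cosh_def power2_eq_square algebra_simps)
  show "integrable lborel (\<lambda>\<theta>. gauss Q 0 \<theta> * (cosh (s * (\<theta> \<bullet> v)) - 1))"
    unfolding eq by (intro Bochner_Integration.integrable_diff Bochner_Integration.integrable_add
      integrable_mult_right integrable_gauss)
  show "(\<integral>\<theta>. gauss Q 0 \<theta> * (cosh (s * (\<theta> \<bullet> v)) - 1) \<partial>lborel) = exp (s\<^sup>2 * (w \<bullet> v) / 2) - 1"
    unfolding eq by (simp add: integrable_gauss integral_gauss)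
qed

lemma integrable_second_moment: "integrable lborel (\<lambda>\<theta>. gauss Q 0 \<theta> * (\<theta> \<bullet> v)\<^sup>2)"
proof -
  obtain w where w: "Q w = v" by (rule surjE)
  have "integrable lborel (\<lambda>\<theta>. 2 * (gauss Q 0 \<theta> * (cosh (1 * (\<theta> \<bullet> v)) - 1)))"
    by (intro integrable_mult_right cosh_moment(1)[OF w])
  then show ?thesis
  proof (rule Bochner_Integration.integrable_bound)
    have "gauss Q 0 \<theta> * (\<theta> \<bullet> v)\<^sup>2 \<le> 2 * (gauss Q 0 \<theta> * (cosh (1 * (\<theta> \<bullet> v)) - 1))" for \<theta>
      using mult_left_mono[OF cosh_minus_one_ge[of "\<theta> \<bullet> v"] less_imp_le[OF gauss_pos[of 0 \<theta>]]]
      by simp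
    then show "AE \<theta> in lborel. norm (gauss Q 0 \<theta> * (\<theta> \<bullet> v)\<^sup>2) \<le>
        norm (2 * (gauss Q 0 \<theta> * (cosh (1 * (\<theta> \<bullet> v)) - 1)))"
      using gauss_pos by (intro AE_I2) (smt (verit) real_norm_def mult_nonneg_nonneg zero_le_power2)
  qed simp
qed

text \<open>The second moment is the limit of the scaled cosh moments as the scale tends to zero,
  with the unit-scale moment as dominating function.\<close>

lemma second_moment:
  assumes w: "Q w = v"
  shows "(\<integral>\<theta>. gauss Q 0 \<theta> * (\<theta> \<bullet> v)\<^sup>2 \<partial>lborel) = w \<bullet> v"
proof -
  \<comment> \<open>These scales lie in (0, 1], the range of \<open>cosh_scaled_le\<close>, and are
    never 0, so division by their squares is safe.\<close>
  define s where "s n = 1 / real (Suc n)" for n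
  have s: "0 < s n" "s n \<le> 1" for n by (auto simp: s_def)
  have s0: "filterlim s (at 0) sequentially"
    unfolding filterlim_at using s LIMSEQ_inverse_real_of_nat
    by (auto simp: s_def[abs_def] inverse_eq_divide)
  define F where "F n \<theta> = gauss Q 0 \<theta> * (cosh (s n * (\<theta> \<bullet> v)) - 1) / (s n)\<^sup>2" for n \<theta>
  \<comment> \<open>The half-angle identity turns the quotient into twice the square of a difference
    quotient of sinh at 0.\<close>
  have lim_cosh: "((\<lambda>r::real. (cosh (r * a) - 1) / r\<^sup>2) \<longlongrightarrow> a\<^sup>2 / 2) (at 0)" for a
  proof -
    have "((\<lambda>r::real. 2 * (sinh (r * (a/2)) / r)\<^sup>2) \<longlongrightarrow> 2 * (a/2)\<^sup>2) (at 0)"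
    proof (intro tendsto_mult tendsto_const tendsto_power)
      have "((\<lambda>r. sinh (r * (a/2))) has_real_derivative (a/2)) (at 0)"
        by (auto intro!: derivative_eq_intros)
      then show "((\<lambda>r. sinh (r * (a/2)) / r) \<longlongrightarrow> a/2) (at 0)"
        by (simp add: DERIV_def)
    qed
    also have "(\<lambda>r. 2 * (sinh (r * (a/2)) / r)\<^sup>2) = (\<lambda>r. (cosh (r * a) - 1) / r\<^sup>2)"
      using cosh_double_sinh[of "r * (a/2)" for r] by (simp add: power_divide)
    also have "2 * (a/2)\<^sup>2 = a\<^sup>2 / 2" by (simp add: power_divide)
    finally show ?thesis .
  qed
  have lim_exp: "((\<lambda>r::real. (exp (r\<^sup>2 * a / 2) - 1) / r\<^sup>2) \<longlongrightarrow> a / 2) (at 0)" for a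
  proof -
    have "((\<lambda>u. (exp (u * a / 2) - 1) / u) \<longlongrightarrow> a/2) (at 0)"
    proof -
      have "((\<lambda>u. exp (u * a / 2)) has_real_derivative (a/2)) (at 0)"
        by (auto intro!: derivative_eq_intros)
      then show ?thesis by (simp add: DERIV_def)
    qed
    moreover have "filterlim (\<lambda>r::real. r\<^sup>2) (at 0) (at 0)"
      unfolding filterlim_at by (auto intro!: tendsto_eq_intros simp: eventually_at_filter)
    ultimately show ?thesis by (rule filterlim_compose)
  qed
  have "(\<lambda>n. \<integral>\<theta>. F n \<theta> \<partial>lborel) \<longlonglongrightarrow> (\<integral>\<theta>. gauss Q 0 \<theta> * ((\<theta> \<bullet> v)\<^sup>2 / 2) \<partial>lborel)"
  proof (rule integral_dominated_convergence[where w="\<lambda>\<theta>. gauss Q 0 \<theta> * (cosh (1 * (\<theta> \<bullet> v)) - 1)"])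
    show "integrable lborel (\<lambda>\<theta>. gauss Q 0 \<theta> * (cosh (1 * (\<theta> \<bullet> v)) - 1))"
      by (rule cosh_moment(1)[OF w])
    show "AE \<theta> in lborel. (\<lambda>n. F n \<theta>) \<longlonglongrightarrow> gauss Q 0 \<theta> * ((\<theta> \<bullet> v)\<^sup>2 / 2)"
    proof (rule AE_I2)
      fix \<theta>
      have "(\<lambda>n. gauss Q 0 \<theta> * ((cosh (s n * (\<theta> \<bullet> v)) - 1) / (s n)\<^sup>2)) \<longlonglongrightarrow> gauss Q 0 \<theta> * ((\<theta> \<bullet> v)\<^sup>2 / 2)"
        by (intro tendsto_mult tendsto_const filterlim_compose[OF lim_cosh s0])
      then show "(\<lambda>n. F n \<theta>) \<longlonglongrightarrow> gauss Q 0 \<theta> * ((\<theta> \<bullet> v)\<^sup>2 / 2)" by (simp add: F_def)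
    qed
    fix n
    show "AE \<theta> in lborel. norm (F n \<theta>) \<le> gauss Q 0 \<theta> * (cosh (1 * (\<theta> \<bullet> v)) - 1)"
    proof (rule AE_I2)
      fix \<theta>
      have "(cosh (s n * (\<theta> \<bullet> v)) - 1) / (s n)\<^sup>2 \<le> cosh (\<theta> \<bullet> v) - 1"
        using cosh_scaled_le[of "s n" "\<theta> \<bullet> v"] s[of n] by (simp add: field_simps)
      then have "gauss Q 0 \<theta> * ((cosh (s n * (\<theta> \<bullet> v)) - 1) / (s n)\<^sup>2) \<le> gauss Q 0 \<theta> * (cosh (\<theta> \<bullet> v) - 1)"
        by (intro mult_left_mono less_imp_le[OF gauss_pos])
      moreover have "0 \<le> F n \<theta>"
        unfolding F_def using gauss_pos[of 0 \<theta>] cosh_real_ge_1[of "s n * (\<theta> \<bullet> v)"] by simp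
      ultimately show "norm (F n \<theta>) \<le> gauss Q 0 \<theta> * (cosh (1 * (\<theta> \<bullet> v)) - 1)"
        by (simp add: F_def)
    qed
  qed (auto simp: F_def cosh_def)
  moreover have "(\<lambda>n. \<integral>\<theta>. F n \<theta> \<partial>lborel) \<longlonglongrightarrow> (w \<bullet> v) / 2"
  proof -
    have "(\<integral>\<theta>. F n \<theta> \<partial>lborel) = (exp ((s n)\<^sup>2 * (w \<bullet> v) / 2) - 1) / (s n)\<^sup>2" for n
      unfolding F_def by (simp add: cosh_moment(2)[OF w])
    then show ?thesis using filterlim_compose[OF lim_exp s0] by simp
  qed
  ultimately have "(\<integral>\<theta>. gauss Q 0 \<theta> * ((\<theta> \<bullet> v)\<^sup>2 / 2) \<partial>lborel) = (w \<bullet> v) / 2"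
    by (rule LIMSEQ_unique)
  then show ?thesis by simp
qed

text \<open>The density is even and the functional odd, so reflection shows that the integral equals
  its own negative.\<close>

lemma first_moment: "(\<integral>\<theta>. gauss Q 0 \<theta> * (\<theta> \<bullet> v) \<partial>lborel) = 0"
proof -
  have "(\<integral>\<theta>. gauss Q 0 (- \<theta>) * (- \<theta> \<bullet> v) \<partial>lborel) = (\<integral>\<theta>. gauss Q 0 \<theta> * (\<theta> \<bullet> v) \<partial>lborel)"
    by (rule lborel_integral_uminus) simp
  moreover have "gauss Q 0 (- \<theta>) = gauss Q 0 \<theta>" for \<theta>
    by (simp add: gauss_def linear_neg[OF lin])
  ultimately show ?thesis by simp
qed

lemma gauss_centred_moments:
  shows "integrable lborel (\<lambda>\<theta>. gauss Q \<mu> \<theta> * ((\<theta> - \<mu>) \<bullet> v)\<^sup>2)"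
    and "Q w = v \<Longrightarrow> (\<integral>\<theta>. gauss Q \<mu> \<theta> * ((\<theta> - \<mu>) \<bullet> v)\<^sup>2 \<partial>lborel) = w \<bullet> v"
    and "integrable lborel (\<lambda>\<theta>. gauss Q \<mu> \<theta> * ((\<theta> - \<mu>) \<bullet> v))"
    and "(\<integral>\<theta>. gauss Q \<mu> \<theta> * ((\<theta> - \<mu>) \<bullet> v) \<partial>lborel) = 0"
proof -
  show int2: "integrable lborel (\<lambda>\<theta>. gauss Q \<mu> \<theta> * ((\<theta> - \<mu>) \<bullet> v)\<^sup>2)"
    using lborel_integrable_shift[OF integrable_second_moment, of \<mu>] by (simp flip: gauss_shift)
  show "(\<integral>\<theta>. gauss Q \<mu> \<theta> * ((\<theta> - \<mu>) \<bullet> v)\<^sup>2 \<partial>lborel) = w \<bullet> v" if "Q w = v"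
    using lborel_integral_shift[of "\<lambda>\<theta>. gauss Q 0 \<theta> * (\<theta> \<bullet> v)\<^sup>2" \<mu>] second_moment[OF that]
    by (simp flip: gauss_shift)
  show "(\<integral>\<theta>. gauss Q \<mu> \<theta> * ((\<theta> - \<mu>) \<bullet> v) \<partial>lborel) = 0"
    using lborel_integral_shift[of "\<lambda>\<theta>. gauss Q 0 \<theta> * (\<theta> \<bullet> v)" \<mu>] first_moment
    by (simp flip: gauss_shift)
  have "integrable lborel (\<lambda>\<theta>. gauss Q \<mu> \<theta> + gauss Q \<mu> \<theta> * ((\<theta> - \<mu>) \<bullet> v)\<^sup>2)"
    by (intro Bochner_Integration.integrable_add integrable_gauss int2)
  then show "integrable lborel (\<lambda>\<theta>. gauss Q \<mu> \<theta> * ((\<theta> - \<mu>) \<bullet> v))"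
  proof (rule Bochner_Integration.integrable_bound)
    have ab: "\<bar>a\<bar> \<le> 1 + a\<^sup>2" for a :: real
      using sum_squares_bound[of "\<bar>a\<bar>" 1] by (simp add: power2_eq_square)
    show "AE \<theta> in lborel. norm (gauss Q \<mu> \<theta> * ((\<theta> - \<mu>) \<bullet> v)) \<le>
        norm (gauss Q \<mu> \<theta> + gauss Q \<mu> \<theta> * ((\<theta> - \<mu>) \<bullet> v)\<^sup>2)"
    proof (rule AE_I2)
      fix \<theta>
      have "gauss Q \<mu> \<theta> * \<bar>(\<theta> - \<mu>) \<bullet> v\<bar> \<le> gauss Q \<mu> \<theta> * (1 + ((\<theta> - \<mu>) \<bullet> v)\<^sup>2)"
        by (intro mult_left_mono ab less_imp_le[OF gauss_pos])
      then show "norm (gauss Q \<mu> \<theta> * ((\<theta> - \<mu>) \<bullet> v)) \<le>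
        norm (gauss Q \<mu> \<theta> + gauss Q \<mu> \<theta> * ((\<theta> - \<mu>) \<bullet> v)\<^sup>2)"
        using gauss_pos[of \<mu> \<theta>] by (simp add: abs_mult distrib_left)
    qed
  qed simp
qed

text \<open>The variance is the inverse precision evaluated at \<open>v\<close>; the inverse enters
  only through a solution \<open>w\<close> of \<open>Q w = v\<close>.\<close>

lemma dvar_gauss:
  assumes "Q w = v"
  shows "dvar (gauss Q \<mu>) (\<lambda>\<theta>. \<theta> \<bullet> v) = w \<bullet> v"
proof -
  have eq: "gauss Q \<mu> \<theta> * (\<theta> \<bullet> v) = gauss Q \<mu> \<theta> * ((\<theta> - \<mu>) \<bullet> v) + (\<mu> \<bullet> v) * gauss Q \<mu> \<theta>" for \<theta>
    by (simp add: inner_diff algebra_simps)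
  have "(\<integral>\<theta>. gauss Q \<mu> \<theta> * (\<theta> \<bullet> v) \<partial>lborel) = \<mu> \<bullet> v"
    unfolding eq by (simp add: gauss_centred_moments(3,4) integrable_gauss integral_gauss)
  then show ?thesis
    unfolding dvar_def using gauss_centred_moments(2)[OF assms, of \<mu>] by (simp add: inner_diff)
qed

end

text \<open>The variance ratio compares the inverses of \<open>R\<close> and \<open>Q\<close>. A
  lower bound of \<open>Q\<close> by \<open>k\<close> times \<open>R\<close> reverses under
  inversion into the bound \<open>k\<close> on every ratio, and a generalised eigenvector
  \<open>u\<close> attains it in the direction \<open>R u\<close>.\<close>

lemma UQF_gauss:
  assumes "spd Q" "spd R"
    and le: "\<And>u. k * (u \<bullet> R u) \<le> u \<bullet> Q u"
    and u: "u \<noteq> 0" "Q u = k *\<^sub>R R u"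
  shows "UQF (gauss R \<mu>) (gauss Q \<mu>') = k"
proof -
  interpret Q: spd Q by fact
  interpret R: spd R by fact
  \<comment> \<open>Both forms are positive at \<open>u\<close>, so the eigenvalue relation fixes
    the sign of \<open>k\<close>.\<close>
  have k: "k > 0"
    using Q.pos[OF u(1)] R.pos[OF u(1)] u(2) by (simp add: zero_less_mult_iff)
  show ?thesis
    unfolding UQF_def
  proof (rule cInf_eq_minimum)
    have "dvar (gauss R \<mu>) (\<lambda>\<theta>. \<theta> \<bullet> R u) = u \<bullet> R u" by (rule R.dvar_gauss) simp
    moreover
    have "dvar (gauss Q \<mu>') (\<lambda>\<theta>. \<theta> \<bullet> R u) = (u /\<^sub>R k) \<bullet> R u"
      using k u(2) by (intro Q.dvar_gauss) (simp add: linear_cmul[OF Q.lin] field_simps)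
    then have "dvar (gauss Q \<mu>') (\<lambda>\<theta>. \<theta> \<bullet> R u) = (u \<bullet> R u) / k"
      by (simp add: divide_inverse mult.commute)
    moreover have "R u \<noteq> 0" using R.pos[OF u(1)] by auto
    ultimately show "k \<in> {dvar (gauss R \<mu>) (\<lambda>\<theta>. \<theta> \<bullet> v) / dvar (gauss Q \<mu>') (\<lambda>\<theta>. \<theta> \<bullet> v) |v. v \<noteq> 0}"
      using k R.pos[OF u(1)] by (intro CollectI exI[of _ "R u"]) simp
  next
    fix r assume "r \<in> {dvar (gauss R \<mu>) (\<lambda>\<theta>. \<theta> \<bullet> v) / dvar (gauss Q \<mu>') (\<lambda>\<theta>. \<theta> \<bullet> v) |v. v \<noteq> 0}"
    then obtain v where v: "v \<noteq> 0"
      and r: "r = dvar (gauss R \<mu>) (\<lambda>\<theta>. \<theta> \<bullet> v) / dvar (gauss Q \<mu>') (\<lambda>\<theta>. \<theta> \<bullet> v)" by blast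
    obtain a where a: "Q a = v" by (rule Q.surjE)
    obtain b where b: "R b = v" by (rule R.surjE)
    have a0: "a \<bullet> v > 0" using Q.pos[of a] a v linear_0[OF Q.lin] by auto
    \<comment> \<open>Expanding this square transfers the bound from the operators to their
      inverses: \<open>R b\<close> and \<open>Q a\<close> both equal \<open>v\<close>, so every term
      except \<open>a \<bullet> R a\<close> is a variance, and that term is controlled by the
      hypothesis.\<close>
    have "0 \<le> (k *\<^sub>R a - b) \<bullet> R (k *\<^sub>R a - b)" by (rule R.nonneg)
    also have "\<dots> = k * (k * (a \<bullet> R a)) - 2 * k * (a \<bullet> v) + b \<bullet> v"
      unfolding R.form_diff by (simp add: b linear_cmul[OF R.lin])
    also have "k * (k * (a \<bullet> R a)) \<le> k * (a \<bullet> v)"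
      using le[of a] k a by (intro mult_left_mono) auto
    finally have "k * (a \<bullet> v) \<le> b \<bullet> v" by simp
    then show "k \<le> r"
      unfolding r R.dvar_gauss[OF b] Q.dvar_gauss[OF a] using a0 by (simp add: field_simps)
  qed
qed

section \<open>Eigenvalues of symmetric matrices\<close>

text \<open>Induction on the dimension: a maximiser of the Rayleigh quotient on the unit sphere of
  \<open>S\<close> is an eigenvector, and its orthogonal complement inside \<open>S\<close> is again
  invariant. An arbitrary invariant \<open>S\<close> is allowed so that the result also applies to
  the complement of the constant vector.\<close>

lemma symmetric_eigenbasis:
  fixes f :: "'a::euclidean_space \<Rightarrow> 'a"
  assumes lin: "linear f" and sym: "\<And>x y. f x \<bullet> y = x \<bullet> f y"
    and "subspace S" "f ` S \<subseteq> S"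
  shows "\<exists>B d. B \<subseteq> S \<and> pairwise orthogonal B \<and> (\<forall>b\<in>B. norm b = 1 \<and> f b = d b *\<^sub>R b) \<and> span B = S"
  using assms(3,4)
proof (induction "dim S" arbitrary: S rule: less_induct)
  case less
  show ?case
  proof (cases "S \<subseteq> {0}")
    case True
    then have "S = {0}" using subspace_0[OF less.prems(1)] by auto
    then show ?thesis by (intro exI[of _ "{}"]) auto
  next
    case False
    then obtain z where z: "z \<in> S" "z \<noteq> 0" by auto
    have scale: "a *\<^sub>R x \<in> S" if "x \<in> S" for a x by (rule subspace_scale[OF less.prems(1) that])
    have "z /\<^sub>R norm z \<in> S \<inter> sphere 0 1" using scale[OF z(1)] z(2) by auto
    moreover have "compact (S \<inter> sphere 0 1)"
      by (simp add: closed_Int_compact closed_subspace less.prems(1))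
    moreover have "continuous_on (S \<inter> sphere 0 1) (\<lambda>x. x \<bullet> f x)"
      by (intro continuous_intros linear_continuous_on linear_conv_bounded_linear[THEN iffD1] lin)
    ultimately have "\<exists>u\<in>S \<inter> sphere 0 1. \<forall>x\<in>S \<inter> sphere 0 1. x \<bullet> f x \<le> u \<bullet> f u"
      by (intro continuous_attains_sup) auto
    then obtain u where u: "u \<in> S" "norm u = 1"
      and max: "\<And>x. x \<in> S \<Longrightarrow> norm x = 1 \<Longrightarrow> x \<bullet> f x \<le> u \<bullet> f u"
      by auto
    define l where "l = u \<bullet> f u"
    define g where "g x = l * (x \<bullet> x) - x \<bullet> f x" for x
    have g_nonneg: "0 \<le> g x" if "x \<in> S" for x
    proof (cases "x = 0")
      case False
      have "(x /\<^sub>R norm x) \<bullet> f (x /\<^sub>R norm x) \<le> l"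
        unfolding l_def using False by (intro max scale that) auto
      then have "x \<bullet> f x / (norm x)\<^sup>2 \<le> l"
        by (simp add: linear_cmul[OF lin] power2_eq_square field_simps)
      then show ?thesis
        using False by (simp add: g_def power2_norm_eq_inner[symmetric] field_simps)
    qed (simp add: g_def)
    \<comment> \<open>First-order condition at the maximiser of the Rayleigh quotient.\<close>
    define x where "x = l *\<^sub>R u - f u"
    have "f u \<in> S" using less.prems(2) u by auto
    then have xS: "x \<in> S" unfolding x_def
      by (intro subspace_diff less.prems scale u)
    \<comment> \<open>\<open>g\<close> is nonnegative on \<open>S\<close> and vanishes at
      \<open>u\<close>; here it is expanded along the line through \<open>u\<close> in direction
      \<open>x\<close>.\<close>
    have quad: "0 \<le> 2 * s * (x \<bullet> x) + s\<^sup>2 * g x" for s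
    proof -
      have "0 \<le> g (u + s *\<^sub>R x)"
        by (intro g_nonneg subspace_add less.prems scale u xS)
      also have "\<dots> = g u + 2 * s * (l * (u \<bullet> x) - f u \<bullet> x) + s\<^sup>2 * g x"
        unfolding g_def using sym[of u x]
        by (simp add: linear_add[OF lin] linear_cmul[OF lin] inner_add inner_commute power2_eq_square algebra_simps)
      also have "g u = 0" using u by (simp add: g_def l_def flip: power2_norm_eq_inner)
      also have "l * (u \<bullet> x) - f u \<bullet> x = x \<bullet> x" by (simp add: x_def inner_diff inner_commute algebra_simps)
      finally show ?thesis by simp
    qed
    \<comment> \<open>The step \<open>- (x \<bullet> x) / c\<close> makes the quadratic strictly
      negative unless \<open>x = 0\<close>; adding 1 keeps \<open>c\<close> positive when
      \<open>g x = 0\<close>.\<close>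
    define c where "c = g x + 1"
    have c: "c > 0" using g_nonneg[OF xS] by (simp add: c_def)
    have "0 \<le> 2 * (- (x \<bullet> x) / c) * (x \<bullet> x) + (- (x \<bullet> x) / c)\<^sup>2 * (c - 1)"
      using quad[of "- (x \<bullet> x) / c"] by (simp add: c_def)
    also have "\<dots> = - (x \<bullet> x)\<^sup>2 * (c + 1) / c\<^sup>2"
      using c by (simp add: power2_eq_square field_simps)
    finally have "(x \<bullet> x)\<^sup>2 * (c + 1) \<le> 0"
      using c by (simp add: divide_le_0_iff zero_le_divide_iff mult_le_0_iff)
    then have "x \<bullet> x = 0" using c by (simp add: mult_le_0_iff)
    then have fu: "f u = l *\<^sub>R u" by (simp add: x_def)
    define S' where "S' = {x \<in> S. x \<bullet> u = 0}"
    have sub': "subspace S'"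
      using less.prems(1) by (auto simp: S'_def subspace_def inner_add)
    have "f ` S' \<subseteq> S'"
      using less.prems(2) sym[of _ u] by (auto simp: S'_def fu)
    have "u \<notin> S'" using u by (auto simp: S'_def dot_square_norm)
    moreover have "S' \<subseteq> S" by (auto simp: S'_def)
    ultimately have "S' \<subset> S" using u by blast
    then have "span S' \<subset> span S"
      using sub' less.prems(1) by (simp add: span_eq_iff[THEN iffD2])
    then have "dim S' < dim S" by (rule dim_psubset)
    then obtain B d where B: "B \<subseteq> S'" "pairwise orthogonal B"
        "\<forall>b\<in>B. norm b = 1 \<and> f b = d b *\<^sub>R b" "span B = S'"
      using less.hyps[OF _ sub' \<open>f ` S' \<subseteq> S'\<close>] by blast
    have uB: "u \<notin> B" using B(1) \<open>u \<notin> S'\<close> by auto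
    show ?thesis
    proof (intro exI[of _ "insert u B"] exI[of _ "d(u := l)"] conjI)
      show "insert u B \<subseteq> S" using u B(1) by (auto simp: S'_def)
      show "pairwise orthogonal (insert u B)"
        using B(1,2) by (auto simp: pairwise_insert orthogonal_def S'_def inner_commute)
      show "\<forall>b\<in>insert u B. norm b = 1 \<and> f b = (d(u := l)) b *\<^sub>R b"
        using B(3) u uB fu by auto
      show "span (insert u B) = S"
      proof
        show "span (insert u B) \<subseteq> S"
          using u B(1) less.prems(1) by (intro span_minimal) (auto simp: S'_def)
        show "S \<subseteq> span (insert u B)"
        proof
          fix x assume x: "x \<in> S"
          have "x - (x \<bullet> u) *\<^sub>R u \<in> S'"
            using x u by (auto simp: S'_def inner_diff dot_square_norm intro!: subspace_diff less.prems scale)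
          then show "x \<in> span (insert u B)"
            using B(4) by (auto simp: span_insert)
        qed
      qed
    qed
  qed
qed

text \<open>The matrix \<open>P\<close> with columns \<open>B\<close> conjugates the characteristic
  matrix \<open>X\<close> to the diagonal matrix \<open>E\<close>. All of this takes place over
  complex polynomials, so that \<open>det\<close> is multiplicative for the very matrix in
  \<open>charpoly\<close>.\<close>

lemma charpoly_orthonormal_eigenbasis:
  fixes M :: "real^'n^'n"
  assumes orth: "pairwise orthogonal B" and unit: "\<And>b. b \<in> B \<Longrightarrow> norm b = 1"
    and eig: "\<And>b. b \<in> B \<Longrightarrow> M *v b = d b *\<^sub>R b" and card: "finite B" "card B = CARD('n)"
  shows "charpoly M = (\<Prod>b\<in>B. [:- complex_of_real (d b), 1:])"
proof -
  obtain s :: "'n \<Rightarrow> real^'n" where s: "bij_betw s UNIV B"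
    using finite_same_card_bij[of "UNIV :: 'n set" B] card by auto
  have sB: "s j \<in> B" for j using s by (auto simp: bij_betw_def)
  have s_inner: "s i \<bullet> s j = (if i = j then 1 else 0)" for i j
    using orth unit[OF sB] sB bij_betw_imp_inj_on[OF s]
    by (auto simp: pairwise_def orthogonal_def inj_eq dot_square_norm)
  define c where "c x = [:complex_of_real x:]" for x
  have c_mult: "c x * c y = c (x * y)" for x y by (simp add: c_def)
  have c_sum: "(\<Sum>k\<in>A. c (h k)) = c (\<Sum>k\<in>A. h k)" for h and A :: "'n set"
    by (induction A rule: infinite_finite_induct) (auto simp: c_def)
  define X where "X = (\<chi> i j. (if i = j then [:0, 1:] else 0) - c (M $ i $ j))"
  define P where "P = (\<chi> i j. c (s j $ i))"
  define E where "E = (\<chi> i j. if i = j then [:- complex_of_real (d (s j)), 1:] else 0)"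
  have ortho: "transpose P ** P = mat 1"
  proof -
    have "(\<Sum>k\<in>UNIV. c (s i $ k) * c (s j $ k)) = (if i = j then 1 else 0)" for i j
      unfolding c_mult c_sum using s_inner[of i j] by (auto simp: inner_vec_def c_def)
    then show ?thesis
      by (simp add: vec_eq_iff matrix_matrix_mult_def transpose_def P_def mat_def)
  qed
  have XP: "X ** P = P ** E"
  proof -
    have "(X ** P) $ i $ j = (P ** E) $ i $ j" for i j
    proof -
      have "(X ** P) $ i $ j = [:0, 1:] * c (s j $ i) - (\<Sum>k\<in>UNIV. c (M $ i $ k) * c (s j $ k))"
        by (simp add: matrix_matrix_mult_def X_def P_def left_diff_distrib sum_subtractf if_distrib
            [of "\<lambda>x. x * _"] cong: if_cong)
      also have "(\<Sum>k\<in>UNIV. c (M $ i $ k) * c (s j $ k)) = c ((M *v s j) $ i)"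
        unfolding c_mult c_sum by (simp add: matrix_vector_mult_def)
      also have "\<dots> = c (d (s j) * s j $ i)"
        unfolding eig[OF sB] by simp
      also have "[:0, 1:] * c (s j $ i) - c (d (s j) * s j $ i)
          = c (s j $ i) * [:- complex_of_real (d (s j)), 1:]"
        by (simp add: c_def)
      also have "\<dots> = (P ** E) $ i $ j"
        by (simp add: matrix_matrix_mult_def P_def E_def if_distrib cong: if_cong)
      finally show ?thesis .
    qed
    then show ?thesis by (simp add: vec_eq_iff)
  qed
  \<comment> \<open>Only \<open>det P \<noteq> 0\<close> is required, since polynomials form an
    integral domain and the factor can be cancelled.\<close>
  have "det P * det P = 1" using arg_cong[OF ortho, of det] by (simp add: det_mul)
  then have "det P \<noteq> 0" by auto
  moreover have "det X * det P = det P * det E" using arg_cong[OF XP, of det] by (simp add: det_mul)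
  ultimately have "det X = det E" by (simp add: mult.commute)
  also have "det E = (\<Prod>j\<in>UNIV. E $ j $ j)" by (rule det_diagonal) (simp add: E_def)
  also have "\<dots> = (\<Prod>b\<in>B. [:- complex_of_real (d b), 1:])"
    by (simp add: E_def prod.reindex_bij_betw[OF s, symmetric])
  finally show ?thesis by (simp add: charpoly_def X_def c_def)
qed

text \<open>\<open>M\<close> is symmetric and fixes the constant vector, hence preserves its
  orthogonal complement. An eigenbasis there together with the normalised constant vector is a full
  one, so the spectrum is 1 and the numbers \<open>d b\<close> in [0, 1]. The second largest modulus
  is therefore the maximal Rayleigh quotient on the complement.\<close>

lemma second_mod_eig_doubly_stochastic_psd:
  fixes M :: "real^'n^'n"
  defines "lam \<equiv> second_mod_eig M"
  assumes sym: "transpose M = M" and one: "M *v 1 = 1"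
    and psd: "\<And>x. 0 \<le> x \<bullet> (M *v x)" and contr: "\<And>x. x \<bullet> (M *v x) \<le> x \<bullet> x"
  shows "0 \<le> lam"
    and "x \<bullet> 1 = 0 \<Longrightarrow> x \<bullet> (M *v x) \<le> lam * (x \<bullet> x)"
    and "lam = 0 \<or> (\<exists>x. x \<noteq> 0 \<and> x \<bullet> 1 = 0 \<and> M *v x = lam *\<^sub>R x)"
proof -
  define S where "S = {x :: real^'n. x \<bullet> 1 = 0}"
  have sym': "(M *v x) \<bullet> y = x \<bullet> (M *v y)" for x y
    using dot_lmul_matrix[of x M y] sym by (metis transpose_matrix_vector)
  have "subspace S" by (auto simp: S_def subspace_def inner_add)
  moreover have "(*v) M ` S \<subseteq> S" by (auto simp: S_def sym' one)
  ultimately obtain B d where B: "B \<subseteq> S" "pairwise orthogonal B"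
      and eig: "\<And>b. b \<in> B \<Longrightarrow> norm b = 1" "\<And>b. b \<in> B \<Longrightarrow> M *v b = d b *\<^sub>R b" and span: "span B = S"
    using symmetric_eigenbasis[OF matrix_vector_mul_linear[of M] sym'] by metis
  have one0: "(1 :: real^'n) \<noteq> 0" by (simp add: vec_eq_iff)
  define e :: "real^'n" where "e = 1 /\<^sub>R norm (1 :: real^'n)"
  have e: "norm e = 1" "M *v e = e" using one0 by (auto simp: e_def matrix_vector_mult_scaleR one)
  have Be: "b \<bullet> e = 0" if "b \<in> B" for b using B(1) that by (auto simp: S_def e_def)
  have eB: "e \<notin> B" using Be[of e] e(1) by (auto simp: dot_square_norm)
  have B0: "0 \<notin> B" using eig(1) by force
  have indep: "independent B" by (rule pairwise_orthogonal_independent[OF B(2) B0])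
  have finB: "finite B" using indep by (rule independent_imp_finite)
  have "card (insert e B) = CARD('n)"
  proof -
    have "dim S = DIM(real^'n) - 1"
      unfolding S_def using dim_hyperplane[OF one0] by (simp add: inner_commute)
    moreover have "dim S = card B" using span indep by (metis dim_span dim_eq_card_independent)
    ultimately show ?thesis using eB finB by (simp add: card_insert_if)
  qed
  moreover have "pairwise orthogonal (insert e B)"
    using B(2) Be by (auto simp: pairwise_insert orthogonal_def inner_commute)
  ultimately have "charpoly M = (\<Prod>b\<in>insert e B. [:- complex_of_real ((d(e := 1)) b), 1:])"
    using e eig eB finB by (intro charpoly_orthonormal_eigenbasis) auto
  also have "\<dots> = [:- complex_of_real ((d(e := 1)) e), 1:] * (\<Prod>b\<in>B. [:- complex_of_real ((d(e := 1)) b), 1:])"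
    by (rule prod.insert[OF finB eB])
  also have "(\<Prod>b\<in>B. [:- complex_of_real ((d(e := 1)) b), 1:]) = (\<Prod>b\<in>B. [:- complex_of_real (d b), 1:])"
    by (rule prod.cong[OF refl]) (use eB in auto)
  finally have "charpoly M = [:-1, 1:] * (\<Prod>b\<in>B. [:- complex_of_real (d b), 1:])"
    by (simp only: fun_upd_same of_real_1)
  then have "proots (charpoly M) = {#1#} + (\<Sum>b\<in>B. proots [:- complex_of_real (d b), 1:])"
    by (simp only:) (subst proots_mult, auto simp: proots_prod finB simp del: mult_pCons_left)
  also have "(\<Sum>b\<in>B. proots [:- complex_of_real (d b), 1:]) = image_mset (\<lambda>b. complex_of_real (d b)) (mset_set B)"
    using finB by (induction B rule: finite_induct) auto
  finally have roots: "image_mset cmod (proots (charpoly M)) = add_mset 1 (image_mset (\<lambda>b. \<bar>d b\<bar>) (mset_set B))"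
    by (simp add: image_mset.compositionality comp_def)
  have db: "0 \<le> d b" "d b \<le> 1" if "b \<in> B" for b
    using psd[of b] contr[of b] eig[OF that] by (auto simp: dot_square_norm)
  define sl where "sl = sorted_list_of_multiset (image_mset (\<lambda>b. \<bar>d b\<bar>) (mset_set B))"
  have set_sl: "set sl = d ` B" using finB db by (auto simp: sl_def image_iff) 
  \<comment> \<open>No \<open>d b\<close> exceeds 1, so the eigenvalue of the constant vector comes
    first after reversal and index 1 picks the largest of the others, even when 1 is a multiple
    eigenvalue.\<close>
  have "insort 1 sl = sl @ [1]"
    using set_sl db by (intro sorted_insort_is_snoc) (auto simp: sl_def sorted_sorted_list_of_multiset)
  then have L: "rev (sorted_list_of_multiset (image_mset cmod (proots (charpoly M)))) = 1 # rev sl"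
    unfolding roots by (simp add: sl_def)
  \<comment> \<open>\<open>B\<close> is empty exactly for a matrix of size one, where
    \<open>second_mod_eig\<close> has its default value 0.\<close>
  have lam: "lam = (if B = {} then 0 else last sl)"
    unfolding lam_def second_mod_eig_def L using set_sl
    by (cases sl rule: rev_cases) auto
  show lam0: "0 \<le> lam" 
    unfolding lam using set_sl db last_in_set[of sl] by (cases "sl = []") auto
  have le: "d b \<le> lam" if "b \<in> B" for b
  proof -
    have "sorted sl" by (simp add: sl_def)
    moreover have "d b \<in> set sl" using set_sl that by auto
    ultimately have "d b \<le> last sl" by (cases sl rule: rev_cases) (auto simp: sorted_append)
    then show ?thesis using that lam by auto
  qed
  show "x \<bullet> (M *v x) \<le> lam * (x \<bullet> x)" if "x \<bullet> 1 = 0"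
  proof -
    have exp: "(\<Sum>b\<in>B. (x \<bullet> b) *\<^sub>R b) = x" if "x \<in> S" for x
      using B(2) eig(1) finB span that by (intro orthonormal_basis_expand) auto
    have S: "x \<in> S" "M *v x \<in> S" using that by (auto simp: S_def sym' one)
    have ip: "x \<bullet> y = (\<Sum>b\<in>B. (x \<bullet> b) * (y \<bullet> b))" if "y \<in> S" for y
      by (subst exp[OF that, symmetric]) (simp add: inner_sum_right mult.commute)
    have "x \<bullet> (M *v x) = (\<Sum>b\<in>B. (x \<bullet> b) * (d b * (x \<bullet> b)))"
      unfolding ip[OF S(2)] by (intro sum.cong) (auto simp: sym' eig)
    also have "\<dots> \<le> (\<Sum>b\<in>B. lam * ((x \<bullet> b) * (x \<bullet> b)))"
    proof (intro sum_mono)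
      fix b assume "b \<in> B"
      from mult_right_mono[OF le[OF this], of "(x \<bullet> b) * (x \<bullet> b)"]
      show "(x \<bullet> b) * (d b * (x \<bullet> b)) \<le> lam * ((x \<bullet> b) * (x \<bullet> b))" by (simp add: mult_ac)
    qed
    also have "\<dots> = lam * (x \<bullet> x)" unfolding ip[OF S(1)] by (simp add: sum_distrib_left)
    finally show ?thesis .
  qed
  show "lam = 0 \<or> (\<exists>x. x \<noteq> 0 \<and> x \<bullet> 1 = 0 \<and> M *v x = lam *\<^sub>R x)"
  proof (cases "B = {}")
    case False
    then have "sl \<noteq> []" using set_sl by auto
    then have "last sl \<in> d ` B" using set_sl last_in_set[of sl] by auto
    then obtain b where "b \<in> B" "lam = d b" using False lam by auto
    then show ?thesis using eig(2) B(1) B0 by (auto simp: S_def intro!: exI[of _ b])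
  qed (simp add: lam)
qed

section \<open>The optimal partially factorized approximation\<close>

text \<open>Integrating out the intercept first removes the conditional density, which has mass one,
  and leaves a product of a function of \<open>x\<close> and a function of \<open>y\<close>. The
  masses of \<open>a\<close> and \<open>b\<close> are left open.\<close>

lemma pf_fubini:
  fixes f :: "('g1::finite, 'g2::finite) par \<Rightarrow> real"
  assumes f: "\<And>t x y. f (t, x, y) = c t x y * a x * b y"
    and c: "\<And>x y. (\<integral>t. c t x y \<partial>lborel) = 1"
    and int: "integrable lborel (\<lambda>\<theta>. f \<theta> * (\<phi> (fst (snd \<theta>)) * \<psi> (snd (snd \<theta>))))"
  shows "(\<integral>\<theta>. f \<theta> * (\<phi> (fst (snd \<theta>)) * \<psi> (snd (snd \<theta>))) \<partial>lborel)
    = (\<integral>x. a x * \<phi> x \<partial>lborel) * (\<integral>y. b y * \<psi> y \<partial>lborel)"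
proof -
  let ?F = "\<lambda>\<theta>. f \<theta> * (\<phi> (fst (snd \<theta>)) * \<psi> (snd (snd \<theta>)))"
  have int': "integrable (lborel \<Otimes>\<^sub>M lborel) (case_prod (\<lambda>t z. ?F (t, z)))"
    unfolding lborel_prod using int by (simp add: split_beta')
  have inner: "(\<integral>t. ?F (t, z) \<partial>lborel) = (a (fst z) * \<phi> (fst z)) * (b (snd z) * \<psi> (snd z))" for z
  proof -
    obtain x y where z: "z = (x, y)" by (cases z)
    have "(\<integral>t. ?F (t, z) \<partial>lborel) = (\<integral>t. c t x y * (a x * b y * \<phi> x * \<psi> y) \<partial>lborel)"
      by (simp add: z f mult_ac)
    also have "\<dots> = a x * b y * \<phi> x * \<psi> y" by (simp add: c)
    finally show ?thesis by (simp add: z mult_ac)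
  qed
  have int2: "integrable (lborel \<Otimes>\<^sub>M lborel) (\<lambda>(x, y). (a x * \<phi> x) * (b y * \<psi> y))"
    using lborel_pair.integrable_snd[OF int', unfolded inner] by (simp only: lborel_prod split_beta')
  have "integral\<^sup>L lborel ?F = (\<integral>z. (a (fst z) * \<phi> (fst z)) * (b (snd z) * \<psi> (snd z)) \<partial>lborel)"
    using lborel_pair.integral_snd[OF int', unfolded inner] by (simp add: lborel_prod split_beta')
  also have "\<dots> = (\<integral>x. \<integral>y. (a x * \<phi> x) * (b y * \<psi> y) \<partial>lborel \<partial>lborel)"
    using lborel_pair.integral_fst[OF int2] unfolding lborel_prod by (simp only: split_beta')
  also have "\<dots> = (\<integral>x. a x * \<phi> x \<partial>lborel) * (\<integral>y. b y * \<psi> y \<partial>lborel)"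
    by simp
  finally show ?thesis .
qed

text \<open>Under the family the two blocks are independent: apply the factorisation three times,
  with one or neither test function replaced by 1.\<close>

lemma pf_family_indep:
  fixes f :: "('g1::finite, 'g2::finite) par \<Rightarrow> real"
  assumes pf: "pf_family f"
    and "integrable lborel (\<lambda>\<theta>. f \<theta> * (\<phi> (fst (snd \<theta>)) * \<psi> (snd (snd \<theta>))))"
    and "integrable lborel (\<lambda>\<theta>. f \<theta> * \<phi> (fst (snd \<theta>)))"
    and "integrable lborel (\<lambda>\<theta>. f \<theta> * \<psi> (snd (snd \<theta>)))"
  shows "(\<integral>\<theta>. f \<theta> * (\<phi> (fst (snd \<theta>)) * \<psi> (snd (snd \<theta>))) \<partial>lborel)
    = (\<integral>\<theta>. f \<theta> * \<phi> (fst (snd \<theta>)) \<partial>lborel) * (\<integral>\<theta>. f \<theta> * \<psi> (snd (snd \<theta>)) \<partial>lborel)"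
proof -
  obtain c a b where f: "\<And>t x y. f (t, x, y) = c t x y * a x * b y"
    and c: "\<And>x y. (\<integral>t. c t x y \<partial>lborel) = 1"
    and ab: "integral\<^sup>L lborel a = 1" "integral\<^sup>L lborel b = 1"
    using pf unfolding pf_family_def by metis
  show ?thesis
    using pf_fubini[where \<phi>=\<phi> and \<psi>=\<psi>, OF f c] pf_fubini[where \<phi>=\<phi> and \<psi>="\<lambda>_. 1", OF f c]
      pf_fubini[where \<phi>="\<lambda>_. 1" and \<psi>=\<psi>, OF f c] assms(2-4) ab by simp
qed

lemma spd_scale:
  fixes Q :: "'a::euclidean_space \<Rightarrow> 'a"
  assumes "spd Q" "c > 0"
  shows "spd (\<lambda>x. c *\<^sub>R Q x)"
proof -
  interpret spd Q by fact
  show ?thesis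
  proof (rule spd.intro)
    show "linear (\<lambda>x. c *\<^sub>R Q x)" using linear_compose_scale_right[OF lin] .
  qed (use assms(2) in \<open>auto simp: sym pos\<close>)
qed

text \<open>The square in \<open>form\<close> is a Gaussian for the intercept whose centre is affine
  in \<open>x\<close> and \<open>y\<close>; the remaining terms are independent Gaussians for the
  blocks.\<close>

lemma pf_family_gauss:
  fixes R :: "('g1::finite, 'g2::finite) par \<Rightarrow> ('g1, 'g2) par"
  assumes R: "spd R" and A: "spd A" and C: "spd C" and N: "N > 0"
    and form: "\<And>t x y. (t, x, y) \<bullet> R (t, x, y) = N * (t + x \<bullet> p + y \<bullet> r)\<^sup>2 + x \<bullet> A x + y \<bullet> C y"
  shows "pf_family (gauss R \<mu>)"
proof -
  interpret R: spd R by fact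
  interpret A: spd A by fact
  interpret C: spd C by fact
  interpret T: spd "\<lambda>s::real. N * s"
    using N by unfold_locales (auto simp: linear_iff algebra_simps mult_less_0_iff zero_less_mult_iff)
  obtain m0 m1 m2 where \<mu>: "\<mu> = (m0, m1, m2)" by (cases \<mu>) auto
  define c where "c t x y = gauss (\<lambda>s::real. N * s) (m0 - (x - m1) \<bullet> p - (y - m2) \<bullet> r) t" for t x y
  \<comment> \<open>\<open>k\<close> compares the product of the three normalisers with the joint
    one. Its value 1 comes from integrating both sides of the factorisation, not from evaluating any
    normaliser.\<close>
  define k where "k = (\<integral>s. exp (- (s \<bullet> (N * s)) / 2) \<partial>lborel) * (\<integral>x. exp (- (x \<bullet> A x) / 2) \<partial>lborel)
      * (\<integral>y. exp (- (y \<bullet> C y) / 2) \<partial>lborel) / (\<integral>\<theta>. exp (- (\<theta> \<bullet> R \<theta>) / 2) \<partial>lborel)"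
  have k: "k > 0" unfolding k_def
    by (intro divide_pos_pos mult_pos_pos R.normaliser_pos A.normaliser_pos C.normaliser_pos T.normaliser_pos)
  have f: "gauss R \<mu> (t, x, y) / k = c t x y * gauss A m1 x * gauss C m2 y" for t x y
  proof -
    have e: "((t, x, y) - \<mu>) \<bullet> R ((t, x, y) - \<mu>) = N * (t - (m0 - (x - m1) \<bullet> p - (y - m2) \<bullet> r))\<^sup>2
        + (x - m1) \<bullet> A (x - m1) + (y - m2) \<bullet> C (y - m2)"
      using form[of "t - m0" "x - m1" "y - m2"] by (simp add: \<mu> algebra_simps)
    have "exp (- (((t, x, y) - \<mu>) \<bullet> R ((t, x, y) - \<mu>)) / 2)
      = exp (- (N * (t - (m0 - (x - m1) \<bullet> p - (y - m2) \<bullet> r))\<^sup>2) / 2)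
        * exp (- ((x - m1) \<bullet> A (x - m1)) / 2) * exp (- ((y - m2) \<bullet> C (y - m2)) / 2)"
      unfolding e by (simp add: add_divide_distrib diff_divide_distrib flip: exp_add)
    then show ?thesis
      unfolding gauss_def c_def k_def
      using R.normaliser_pos A.normaliser_pos C.normaliser_pos T.normaliser_pos
      by (simp add: power2_eq_square mult_ac)
  qed
  have c1: "(\<integral>t. c t x y \<partial>lborel) = 1" for x y unfolding c_def by (rule T.integral_gauss)
  have "(\<integral>\<theta>. gauss R \<mu> \<theta> / k \<partial>lborel) = 1"
    using pf_fubini[where f="\<lambda>\<theta>. gauss R \<mu> \<theta> / k" and \<phi>="\<lambda>_. 1" and \<psi>="\<lambda>_. 1", OF f c1]
    by (simp add: R.integrable_gauss A.integral_gauss C.integral_gauss)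
  then have "k = 1" using k by (simp add: R.integral_gauss)
  then show ?thesis
    unfolding pf_family_def
    using f c1 R.gauss_pos A.gauss_pos C.gauss_pos T.gauss_pos
    by (intro conjI exI[of _ c] exI[of _ "gauss A m1"] exI[of _ "gauss C m2"] allI)
      (auto simp: R.integrable_gauss R.integral_gauss A.integrable_gauss A.integral_gauss
        C.integrable_gauss C.integral_gauss c_def T.integrable_gauss less_imp_le)
qed

section \<open>Entropy inequalities and moments\<close>

text \<open>This is \<open>ln z \<le> z - 1\<close> at \<open>z = p * exp r / s\<close>. With
  \<open>r = 0\<close> it is the pointwise Gibbs inequality; with \<open>r\<close> positive it
  trades entropy for a moment.\<close>

lemma young_ln:
  fixes s p r :: real
  assumes "s \<ge> 0" "p > 0"
  shows "s * r \<le> p * exp r - s - s * (ln p - ln s)"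
proof (cases "s = 0")
  case False
  then have s: "s > 0" using assms by simp
  have "ln (p * exp r / s) \<le> p * exp r / s - 1" using assms s by (intro ln_le_minus_one) auto
  then have "ln p + r - ln s \<le> p * exp r / s - 1" using assms s by (simp add: ln_div ln_mult)
  from mult_left_mono[OF this less_imp_le[OF s]] s show ?thesis by (simp add: algebra_simps)
qed (use assms in auto)

text \<open>Equality in \<open>ln z \<le> z - 1\<close> forces \<open>z = 1\<close>; the case
  \<open>s = 0\<close> would give \<open>p = 0\<close>.\<close>

lemma gibbs_eq:
  fixes s p :: real
  assumes "s \<ge> 0" "p > 0" "s * (ln p - ln s) = p - s"
  shows "s = p"
proof (cases "s = 0")
  case False
  then have s: "s > 0" using assms by simp
  have "ln (p / s) = p / s - 1" using assms s by (simp add: ln_div field_simps)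
  then have "p / s = 1" using assms s by (intro ln_eq_minus_one) auto
  then show ?thesis using s by simp
qed (use assms in auto)

lemma integrable_moments:
  fixes f :: "'a::euclidean_space \<Rightarrow> real"
  assumes f[measurable]: "f \<in> borel_measurable borel" "integrable lborel f" and f0: "\<And>\<theta>. 0 \<le> f \<theta>"
    and m2: "\<And>v. integrable lborel (\<lambda>\<theta>. f \<theta> * ((\<theta> - \<mu>) \<bullet> v)\<^sup>2)"
  shows "integrable lborel (\<lambda>\<theta>. f \<theta> * ((\<theta> - \<mu>) \<bullet> v))"
    and "integrable lborel (\<lambda>\<theta>. f \<theta> * (((\<theta> - \<mu>) \<bullet> v) * ((\<theta> - \<mu>) \<bullet> w)))"
proof -
  have two: "2 * \<bar>a * b\<bar> \<le> a\<^sup>2 + b\<^sup>2" for a b :: real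
    using sum_squares_bound[of "\<bar>a\<bar>" "\<bar>b\<bar>"] by (simp add: abs_mult)
  show "integrable lborel (\<lambda>\<theta>. f \<theta> * (((\<theta> - \<mu>) \<bullet> v) * ((\<theta> - \<mu>) \<bullet> w)))"
  proof (rule Bochner_Integration.integrable_bound)
    show "integrable lborel (\<lambda>\<theta>. f \<theta> * ((\<theta> - \<mu>) \<bullet> v)\<^sup>2 + f \<theta> * ((\<theta> - \<mu>) \<bullet> w)\<^sup>2)"
      by (intro Bochner_Integration.integrable_add m2)
    show "AE \<theta> in lborel. norm (f \<theta> * (((\<theta> - \<mu>) \<bullet> v) * ((\<theta> - \<mu>) \<bullet> w)))
        \<le> norm (f \<theta> * ((\<theta> - \<mu>) \<bullet> v)\<^sup>2 + f \<theta> * ((\<theta> - \<mu>) \<bullet> w)\<^sup>2)"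
    proof (rule AE_I2)
      fix \<theta>
      have "\<bar>((\<theta> - \<mu>) \<bullet> v) * ((\<theta> - \<mu>) \<bullet> w)\<bar> \<le> ((\<theta> - \<mu>) \<bullet> v)\<^sup>2 + ((\<theta> - \<mu>) \<bullet> w)\<^sup>2"
        using two[of "(\<theta> - \<mu>) \<bullet> v" "(\<theta> - \<mu>) \<bullet> w"] by linarith
      from mult_left_mono[OF this f0[of \<theta>]]
      show "norm (f \<theta> * (((\<theta> - \<mu>) \<bullet> v) * ((\<theta> - \<mu>) \<bullet> w)))
        \<le> norm (f \<theta> * ((\<theta> - \<mu>) \<bullet> v)\<^sup>2 + f \<theta> * ((\<theta> - \<mu>) \<bullet> w)\<^sup>2)"
        using f0[of \<theta>] by (simp add: abs_mult distrib_left)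
    qed
  qed simp
  show "integrable lborel (\<lambda>\<theta>. f \<theta> * ((\<theta> - \<mu>) \<bullet> v))"
  proof (rule Bochner_Integration.integrable_bound)
    show "integrable lborel (\<lambda>\<theta>. f \<theta> + f \<theta> * ((\<theta> - \<mu>) \<bullet> v)\<^sup>2)"
      by (intro Bochner_Integration.integrable_add m2 f)
    show "AE \<theta> in lborel. norm (f \<theta> * ((\<theta> - \<mu>) \<bullet> v)) \<le> norm (f \<theta> + f \<theta> * ((\<theta> - \<mu>) \<bullet> v)\<^sup>2)"
    proof (rule AE_I2)
      fix \<theta>
      have "\<bar>(\<theta> - \<mu>) \<bullet> v\<bar> \<le> 1 + ((\<theta> - \<mu>) \<bullet> v)\<^sup>2"
        using two[of "(\<theta> - \<mu>) \<bullet> v" 1] by simp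
      from mult_left_mono[OF this f0[of \<theta>]]
      show "norm (f \<theta> * ((\<theta> - \<mu>) \<bullet> v)) \<le> norm (f \<theta> + f \<theta> * ((\<theta> - \<mu>) \<bullet> v)\<^sup>2)"
        using f0[of \<theta>] by (simp add: abs_mult distrib_left)
    qed
  qed simp
qed

text \<open>The bilinear term is a finite sum of products of a functional of the first block and one
  of the second. Independence replaces each factor by its mean, so no covariance remains.\<close>

lemma pf_cross_moment:
  fixes f :: "('g1::finite, 'g2::finite) par \<Rightarrow> real"
  assumes pf: "pf_family f"
    and m2: "\<And>v. integrable lborel (\<lambda>\<theta>. f \<theta> * ((\<theta> - \<mu>) \<bullet> v)\<^sup>2)"
    and mean: "\<And>v. (\<integral>\<theta>. f \<theta> * ((\<theta> - \<mu>) \<bullet> v) \<partial>lborel) = \<delta> \<bullet> v"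
    and B: "linear B"
  shows "integrable lborel (\<lambda>\<theta>. f \<theta> * (fst (snd (\<theta> - \<mu>)) \<bullet> B (snd (snd (\<theta> - \<mu>)))))"
    and "(\<integral>\<theta>. f \<theta> * (fst (snd (\<theta> - \<mu>)) \<bullet> B (snd (snd (\<theta> - \<mu>)))) \<partial>lborel)
      = fst (snd \<delta>) \<bullet> B (snd (snd \<delta>))"
proof -
  have f: "f \<in> borel_measurable borel" "integrable lborel f" "\<And>\<theta>. 0 \<le> f \<theta>"
    using pf by (auto simp: pf_family_def)
  \<comment> \<open>\<open>ex\<close> and \<open>ey\<close> embed block directions into the
    parameter space, so that the moment hypotheses about \<open>\<theta> - \<mu>\<close> cover
    functionals of a single block.\<close>
  define ex where "ex u = (0::real, u :: real^'g1, 0 :: real^'g2)" for u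
  define ey where "ey u = (0::real, 0 :: real^'g1, u :: real^'g2)" for u
  have x: "\<theta> \<bullet> ex u = fst (snd \<theta>) \<bullet> u" and y: "\<theta> \<bullet> ey w = snd (snd \<theta>) \<bullet> w" for \<theta> u w
    by (cases \<theta>; simp add: ex_def ey_def)+
  have split: "fst (snd \<theta>) \<bullet> B (snd (snd \<theta>)) = (\<Sum>b\<in>Basis. (\<theta> \<bullet> ex b) * (\<theta> \<bullet> ey (adjoint B b)))" for \<theta>
    unfolding x y adjoint_works[OF B] by (rule euclidean_inner)
  note int = integrable_moments[OF f m2]
  have prod: "(\<integral>\<theta>. f \<theta> * (((\<theta> - \<mu>) \<bullet> ex u) * ((\<theta> - \<mu>) \<bullet> ey w)) \<partial>lborel) = (\<delta> \<bullet> ex u) * (\<delta> \<bullet> ey w)" for u w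
    using pf_family_indep[OF pf, of "\<lambda>x. (x - fst (snd \<mu>)) \<bullet> u" "\<lambda>y. (y - snd (snd \<mu>)) \<bullet> w"]
      int(1)[of "ex u"] int(1)[of "ey w"] int(2)[of "ex u" "ey w"] mean[of "ex u"] mean[of "ey w"]
    unfolding x y fst_diff snd_diff by simp
  show "integrable lborel (\<lambda>\<theta>. f \<theta> * (fst (snd (\<theta> - \<mu>)) \<bullet> B (snd (snd (\<theta> - \<mu>)))))"
    unfolding split sum_distrib_left by (intro Bochner_Integration.integrable_sum int)
  show "(\<integral>\<theta>. f \<theta> * (fst (snd (\<theta> - \<mu>)) \<bullet> B (snd (snd (\<theta> - \<mu>)))) \<partial>lborel)
      = fst (snd \<delta>) \<bullet> B (snd (snd \<delta>))"
    unfolding split sum_distrib_left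
    by (subst Bochner_Integration.integral_sum) (rule int, simp only: prod)
qed

text \<open>Young's inequality for the entropy, applied to a quarter of the quadratic form.\<close>

lemma (in spd) finite_entropy_imp_second_moment:
  assumes f[measurable]: "f \<in> borel_measurable borel" "integrable lborel f" and f0: "\<And>\<theta>. 0 \<le> f \<theta>"
    and V: "integrable lborel (\<lambda>\<theta>. f \<theta> * (ln (gauss Q \<mu> \<theta>) - ln (f \<theta>)))"
  shows "integrable lborel (\<lambda>\<theta>. f \<theta> * ((\<theta> - \<mu>) \<bullet> v)\<^sup>2)"
proof -
  define q where "q \<theta> = (\<theta> - \<mu>) \<bullet> Q (\<theta> - \<mu>)" for \<theta>
  have [measurable]: "q \<in> borel_measurable borel" unfolding q_def by measurable
  have q0: "0 \<le> q \<theta>" for \<theta> by (simp add: q_def nonneg)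
  interpret H: spd "\<lambda>x. (1/2) *\<^sub>R Q x" by (rule spd_scale) (unfold_locales, simp)
  \<comment> \<open>Multiplying by the exponential of a quarter of the form halves the precision, so
    the tilted density is still integrable.\<close>
  have tilt: "gauss Q \<mu> \<theta> * exp (q \<theta> / 4) =
      (\<integral>\<theta>. exp (- (\<theta> \<bullet> ((1/2) *\<^sub>R Q \<theta>)) / 2) \<partial>lborel) / (\<integral>\<theta>. exp (- (\<theta> \<bullet> Q \<theta>) / 2) \<partial>lborel)
        * gauss (\<lambda>x. (1/2) *\<^sub>R Q x) \<mu> \<theta>" for \<theta>
    using H.normaliser_pos unfolding gauss_def q_def by (simp flip: exp_add)
  have tilt_int: "integrable lborel (\<lambda>\<theta>. gauss Q \<mu> \<theta> * exp (q \<theta> / 4))"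
    unfolding tilt by (intro integrable_mult_right H.integrable_gauss)
  have fq4: "integrable lborel (\<lambda>\<theta>. f \<theta> * (q \<theta> / 4))"
  proof (rule Bochner_Integration.integrable_bound)
    show "integrable lborel (\<lambda>\<theta>. gauss Q \<mu> \<theta> * exp (q \<theta> / 4) - f \<theta> - f \<theta> * (ln (gauss Q \<mu> \<theta>) - ln (f \<theta>)))"
      by (intro Bochner_Integration.integrable_diff tilt_int f V)
    show "AE \<theta> in lborel. norm (f \<theta> * (q \<theta> / 4))
        \<le> norm (gauss Q \<mu> \<theta> * exp (q \<theta> / 4) - f \<theta> - f \<theta> * (ln (gauss Q \<mu> \<theta>) - ln (f \<theta>)))"
    proof (rule AE_I2)
      fix \<theta>
      show "norm (f \<theta> * (q \<theta> / 4))
        \<le> norm (gauss Q \<mu> \<theta> * exp (q \<theta> / 4) - f \<theta> - f \<theta> * (ln (gauss Q \<mu> \<theta>) - ln (f \<theta>)))"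
        using young_ln[OF f0 gauss_pos, of \<theta> "q \<theta> / 4" \<mu> \<theta>] mult_nonneg_nonneg[OF f0[of \<theta>] q0[of \<theta>]] by simp
    qed
  qed simp
  have fq: "integrable lborel (\<lambda>\<theta>. f \<theta> * q \<theta>)"
    using integrable_mult_right[OF fq4, of 4] by simp
  obtain c where c: "c > 0" "\<And>x. c * (norm x)\<^sup>2 \<le> x \<bullet> Q x" using coercive by blast
  show ?thesis
  proof (rule Bochner_Integration.integrable_bound)
    show "integrable lborel (\<lambda>\<theta>. (norm v)\<^sup>2 / c * (f \<theta> * q \<theta>))"
      by (intro integrable_mult_right fq)
    show "AE \<theta> in lborel. norm (f \<theta> * ((\<theta> - \<mu>) \<bullet> v)\<^sup>2) \<le> norm ((norm v)\<^sup>2 / c * (f \<theta> * q \<theta>))"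
    proof (rule AE_I2)
      fix \<theta>
      have "((\<theta> - \<mu>) \<bullet> v)\<^sup>2 \<le> (norm (\<theta> - \<mu>))\<^sup>2 * (norm v)\<^sup>2"
        using Cauchy_Schwarz_ineq[of "\<theta> - \<mu>" v] by (simp add: power2_norm_eq_inner)
      also have "\<dots> \<le> q \<theta> / c * (norm v)\<^sup>2"
        using c by (intro mult_right_mono) (auto simp: q_def field_simps)
      finally have "f \<theta> * ((\<theta> - \<mu>) \<bullet> v)\<^sup>2 \<le> f \<theta> * (q \<theta> / c * (norm v)\<^sup>2)"
        by (intro mult_left_mono f0)
      then show "norm (f \<theta> * ((\<theta> - \<mu>) \<bullet> v)\<^sup>2) \<le> norm ((norm v)\<^sup>2 / c * (f \<theta> * q \<theta>))"
        using f0[of \<theta>] q0[of \<theta>] c(1) by (simp add: mult_ac)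
    qed
  qed simp
qed

lemma (in spd) ln_gauss:
  "ln (gauss Q \<mu> \<theta>) = - ((\<theta> - \<mu>) \<bullet> Q (\<theta> - \<mu>)) / 2 - ln (\<integral>\<theta>. exp (- (\<theta> \<bullet> Q \<theta>) / 2) \<partial>lborel)"
  unfolding gauss_def using normaliser_pos by (simp add: ln_div)

text \<open>The expectation is linear in \<open>v\<close> and hence represented by a vector, the
  displacement of the mean from \<open>\<mu>\<close> when \<open>f\<close> is a density.\<close>

lemma mean_vector:
  fixes f :: "'a::euclidean_space \<Rightarrow> real"
  assumes "\<And>v. integrable lborel (\<lambda>\<theta>. f \<theta> * ((\<theta> - \<mu>) \<bullet> v))"
  shows "\<exists>\<delta>. \<forall>v. (\<integral>\<theta>. f \<theta> * ((\<theta> - \<mu>) \<bullet> v) \<partial>lborel) = \<delta> \<bullet> v"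
proof (intro exI allI)
  fix v
  have "f \<theta> * ((\<theta> - \<mu>) \<bullet> v) = (\<Sum>b\<in>Basis. f \<theta> * ((\<theta> - \<mu>) \<bullet> b) * (v \<bullet> b))" for \<theta>
    by (subst euclidean_inner) (simp add: sum_distrib_left mult.assoc)
  then show "(\<integral>\<theta>. f \<theta> * ((\<theta> - \<mu>) \<bullet> v) \<partial>lborel)
      = (\<Sum>b\<in>Basis. (\<integral>\<theta>. f \<theta> * ((\<theta> - \<mu>) \<bullet> b) \<partial>lborel) *\<^sub>R b) \<bullet> v"
    using assms by (simp add: Bochner_Integration.integral_sum inner_sum_left inner_commute[of v])
qed

section \<open>Maximising the objective over the partially factorized family\<close>

context
  fixes Q R :: "('g1::finite, 'g2::finite) par \<Rightarrow> ('g1, 'g2) par"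
    and B :: "real^'g2 \<Rightarrow> real^'g1" and \<mu> :: "('g1, 'g2) par"
  assumes Q: "spd Q" and R: "spd R" and B: "linear B"
    and form: "\<And>\<theta>. \<theta> \<bullet> Q \<theta> = \<theta> \<bullet> R \<theta> + 2 * (fst (snd \<theta>) \<bullet> B (snd (snd \<theta>)))"
begin

interpretation Q: spd Q by (fact Q)
interpretation R: spd R by (fact R)

text \<open>\<open>pf_objective_le\<close> shows that this is an upper bound of the objective and
  \<open>pf_objective_gauss\<close> that it is attained.\<close>

definition "opt_value = ln (\<integral>\<theta>. exp (- (\<theta> \<bullet> R \<theta>) / 2) \<partial>lborel) - ln (\<integral>\<theta>. exp (- (\<theta> \<bullet> Q \<theta>) / 2) \<partial>lborel)"

text \<open>With m = \<mu> + \<delta> the mean of f, compare f with the Gaussian of precision R centred at m.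
  Only the independence of the two blocks is used about f.\<close>

lemma pf_objective_decomposition:
  assumes pf: "pf_family f"
    and m2: "\<And>v. integrable lborel (\<lambda>\<theta>. f \<theta> * ((\<theta> - \<mu>) \<bullet> v)\<^sup>2)"
    and mean: "\<And>v. (\<integral>\<theta>. f \<theta> * ((\<theta> - \<mu>) \<bullet> v) \<partial>lborel) = \<delta> \<bullet> v"
  shows "integrable lborel (\<lambda>\<theta>. f \<theta> * (ln (gauss Q \<mu> \<theta>) - ln (gauss R (\<mu> + \<delta>) \<theta>)))"
    and "(\<integral>\<theta>. f \<theta> * (ln (gauss Q \<mu> \<theta>) - ln (gauss R (\<mu> + \<delta>) \<theta>)) \<partial>lborel) = opt_value - \<delta> \<bullet> Q \<delta> / 2"
proof -
  have f: "f \<in> borel_measurable borel" "integrable lborel f" "\<And>\<theta>. 0 \<le> f \<theta>" "integral\<^sup>L lborel f = 1"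
    using pf by (auto simp: pf_family_def)
  \<comment> \<open>The \<open>R\<close>-quadratic parts of the two logarithms cancel, so that only
    a constant, a linear term and the coupling term have to be integrated.\<close>
  have eq: "f \<theta> * (ln (gauss Q \<mu> \<theta>) - ln (gauss R (\<mu> + \<delta>) \<theta>)) =
      (opt_value + \<delta> \<bullet> R \<delta> / 2) * f \<theta> - f \<theta> * ((\<theta> - \<mu>) \<bullet> R \<delta>)
      - f \<theta> * (fst (snd (\<theta> - \<mu>)) \<bullet> B (snd (snd (\<theta> - \<mu>))))" for \<theta>
  proof -
    have "(\<theta> - (\<mu> + \<delta>)) \<bullet> R (\<theta> - (\<mu> + \<delta>)) =
        (\<theta> - \<mu>) \<bullet> R (\<theta> - \<mu>) - 2 * ((\<theta> - \<mu>) \<bullet> R \<delta>) + \<delta> \<bullet> R \<delta>"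
      using R.form_diff[of "\<theta> - \<mu>" \<delta>] by (simp add: algebra_simps)
    then have "ln (gauss Q \<mu> \<theta>) - ln (gauss R (\<mu> + \<delta>) \<theta>) =
      opt_value + \<delta> \<bullet> R \<delta> / 2 - (\<theta> - \<mu>) \<bullet> R \<delta> - fst (snd (\<theta> - \<mu>)) \<bullet> B (snd (snd (\<theta> - \<mu>)))"
      unfolding Q.ln_gauss R.ln_gauss opt_value_def form[of "\<theta> - \<mu>"] by (simp add: field_simps)
    then show ?thesis by (simp only:) (simp add: distrib_left right_diff_distrib mult_ac)
  qed
  note cross = pf_cross_moment[OF pf m2 mean B]
  note int1 = integrable_moments(1)[OF f(1-3) m2]
  have "has_bochner_integral lborel (\<lambda>\<theta>. (opt_value + \<delta> \<bullet> R \<delta> / 2) * f \<theta>) (opt_value + \<delta> \<bullet> R \<delta> / 2)"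
    using f by (simp add: has_bochner_integral_iff)
  moreover have "has_bochner_integral lborel (\<lambda>\<theta>. f \<theta> * ((\<theta> - \<mu>) \<bullet> R \<delta>)) (\<delta> \<bullet> R \<delta>)"
    using int1 mean by (simp only: has_bochner_integral_iff simp_thms)
  moreover have "has_bochner_integral lborel (\<lambda>\<theta>. f \<theta> * (fst (snd (\<theta> - \<mu>)) \<bullet> B (snd (snd (\<theta> - \<mu>)))))
      (fst (snd \<delta>) \<bullet> B (snd (snd \<delta>)))"
    using cross by (simp only: has_bochner_integral_iff simp_thms)
  ultimately have "has_bochner_integral lborel (\<lambda>\<theta>. f \<theta> * (ln (gauss Q \<mu> \<theta>) - ln (gauss R (\<mu> + \<delta>) \<theta>)))
      (opt_value + \<delta> \<bullet> R \<delta> / 2 - \<delta> \<bullet> R \<delta> - fst (snd \<delta>) \<bullet> B (snd (snd \<delta>)))"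
    unfolding eq by (intro has_bochner_integral_diff)
  then show "integrable lborel (\<lambda>\<theta>. f \<theta> * (ln (gauss Q \<mu> \<theta>) - ln (gauss R (\<mu> + \<delta>) \<theta>)))"
    and "(\<integral>\<theta>. f \<theta> * (ln (gauss Q \<mu> \<theta>) - ln (gauss R (\<mu> + \<delta>) \<theta>)) \<partial>lborel) = opt_value - \<delta> \<bullet> Q \<delta> / 2"
    using form[of \<delta>] by (simp_all add: has_bochner_integral_iff add_divide_distrib)
qed

text \<open>The gap to \<open>opt_value\<close> is the integral of \<open>G\<close>, a relative
  entropy, plus half the \<open>Q\<close>-form of the mean error \<open>\<delta>\<close>. Both are
  nonnegative; if both vanish, the mean is \<open>\<mu>\<close> and the densities agree almost
  everywhere.\<close>

lemma pf_objective_le: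
  assumes pf: "pf_family f" and V: "integrable lborel (V_integrand (gauss Q \<mu>) f)"
  shows "Vobj (gauss Q \<mu>) f \<le> opt_value"
    and "Vobj (gauss Q \<mu>) f = opt_value \<Longrightarrow> AE \<theta> in lborel. f \<theta> = gauss R \<mu> \<theta>"
proof -
  have f[measurable]: "f \<in> borel_measurable borel" and fi: "integrable lborel f" "integral\<^sup>L lborel f = 1"
    and f0: "\<And>\<theta>. 0 \<le> f \<theta>"
    using pf by (auto simp: pf_family_def)
  have V': "integrable lborel (\<lambda>\<theta>. f \<theta> * (ln (gauss Q \<mu> \<theta>) - ln (f \<theta>)))"
    using V by (simp add: V_integrand_def[abs_def])
  \<comment> \<open>Integrability of the objective already provides second moments, so the mean used
    for the comparison exists.\<close>
  have m2: "integrable lborel (\<lambda>\<theta>. f \<theta> * ((\<theta> - \<mu>) \<bullet> v)\<^sup>2)" for v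
    by (rule Q.finite_entropy_imp_second_moment[OF f fi(1) f0 V'])
  from mean_vector[OF integrable_moments(1)[OF f fi(1) f0 m2]]
  obtain \<delta> where "\<forall>v. (\<integral>\<theta>. f \<theta> * ((\<theta> - \<mu>) \<bullet> v) \<partial>lborel) = \<delta> \<bullet> v" ..
  then have mean: "(\<integral>\<theta>. f \<theta> * ((\<theta> - \<mu>) \<bullet> v) \<partial>lborel) = \<delta> \<bullet> v" for v by (rule spec)
  note dec = pf_objective_decomposition[OF pf m2 mean]
  let ?g = "gauss R (\<mu> + \<delta>)"
  define G where "G \<theta> = ?g \<theta> - f \<theta> - f \<theta> * (ln (?g \<theta>) - ln (f \<theta>))" for \<theta>
  have G0: "0 \<le> G \<theta>" for \<theta>
    using young_ln[OF f0[of \<theta>] R.gauss_pos[of "\<mu> + \<delta>" \<theta>], of 0] by (simp add: G_def)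
  have eq: "G = (\<lambda>\<theta>. ?g \<theta> - f \<theta> - (f \<theta> * (ln (gauss Q \<mu> \<theta>) - ln (f \<theta>))
      - f \<theta> * (ln (gauss Q \<mu> \<theta>) - ln (?g \<theta>))))"
    by (simp add: G_def right_diff_distrib fun_eq_iff)
  have "has_bochner_integral lborel ?g 1" "has_bochner_integral lborel f 1"
    using fi by (simp_all add: has_bochner_integral_iff R.integrable_gauss R.integral_gauss)
  moreover have "has_bochner_integral lborel (\<lambda>\<theta>. f \<theta> * (ln (gauss Q \<mu> \<theta>) - ln (f \<theta>))) (Vobj (gauss Q \<mu>) f)"
    using V' by (simp add: has_bochner_integral_iff Vobj_def V_integrand_def[abs_def])
  moreover have "has_bochner_integral lborel (\<lambda>\<theta>. f \<theta> * (ln (gauss Q \<mu> \<theta>) - ln (?g \<theta>))) (opt_value - \<delta> \<bullet> Q \<delta> / 2)"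
    using dec by (simp only: has_bochner_integral_iff simp_thms)
  ultimately have "has_bochner_integral lborel G (1 - 1 - (Vobj (gauss Q \<mu>) f - (opt_value - \<delta> \<bullet> Q \<delta> / 2)))"
    unfolding eq by (intro has_bochner_integral_diff)
  then have Gint: "integrable lborel G"
    and Vobj: "Vobj (gauss Q \<mu>) f = opt_value - \<delta> \<bullet> Q \<delta> / 2 - integral\<^sup>L lborel G"
    unfolding has_bochner_integral_iff by auto
  have Gi0: "0 \<le> integral\<^sup>L lborel G" by (rule Bochner_Integration.integral_nonneg) (rule G0)
  show "Vobj (gauss Q \<mu>) f \<le> opt_value"
    using Vobj Gi0 Q.nonneg[of \<delta>] by linarith
  assume "Vobj (gauss Q \<mu>) f = opt_value"
  then have 0: "integral\<^sup>L lborel G = 0" "\<delta> \<bullet> Q \<delta> = 0"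
    using Vobj Gi0 Q.nonneg[of \<delta>] by linarith+
  have "\<delta> = 0" using Q.pos[of \<delta>] 0(2) by (metis less_irrefl)
  have "AE \<theta> in lborel. G \<theta> = 0"
    using integral_nonneg_eq_0_iff_AE[OF Gint AE_I2[OF G0]] 0(1) by (rule iffD1)
  then have "AE \<theta> in lborel. f \<theta> = ?g \<theta>"
  proof eventually_elim
    fix \<theta> assume "G \<theta> = 0"
    then have "f \<theta> * (ln (?g \<theta>) - ln (f \<theta>)) = ?g \<theta> - f \<theta>" by (simp add: G_def)
    then show "f \<theta> = ?g \<theta>" by (rule gibbs_eq[OF f0 R.gauss_pos])
  qed
  then show "AE \<theta> in lborel. f \<theta> = gauss R \<mu> \<theta>" using \<open>\<delta> = 0\<close> by simp
qed

lemma pf_objective_gauss: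
  assumes "pf_family (gauss R \<mu>)"
  shows "integrable lborel (V_integrand (gauss Q \<mu>) (gauss R \<mu>))" "Vobj (gauss Q \<mu>) (gauss R \<mu>) = opt_value"
  using pf_objective_decomposition[OF assms, of 0] R.gauss_centred_moments(1,4)
  by (simp_all add: V_integrand_def[abs_def] Vobj_def)

lemma is_pf_opt_gauss:
  assumes "pf_family (gauss R \<mu>)"
  shows "is_pf_opt (gauss Q \<mu>) (gauss R \<mu>)"
    and "is_pf_opt (gauss Q \<mu>) f \<Longrightarrow> AE \<theta> in lborel. f \<theta> = gauss R \<mu> \<theta>"
proof -
  show "is_pf_opt (gauss Q \<mu>) (gauss R \<mu>)"
    unfolding is_pf_opt_def using assms pf_objective_gauss[OF assms] pf_objective_le(1) by auto
  assume "is_pf_opt (gauss Q \<mu>) f"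
  then have "pf_family f" "integrable lborel (V_integrand (gauss Q \<mu>) f)" "Vobj (gauss Q \<mu>) f \<ge> opt_value"
    unfolding is_pf_opt_def using assms pf_objective_gauss[OF assms] by auto
  then show "AE \<theta> in lborel. f \<theta> = gauss R \<mu> \<theta>"
    using pf_objective_le[of f] by (meson order_antisym)
qed

end

text \<open>A maximiser is determined only up to a null set, and \<open>dvar\<close> sees the
  density only under integrals.\<close>

lemma UQF_cong_AE:
  fixes f g :: "'a::euclidean_space \<Rightarrow> real"
  assumes "AE \<theta> in lborel. f \<theta> = g \<theta>"
    and [measurable]: "f \<in> borel_measurable borel" "g \<in> borel_measurable borel"
  shows "UQF f p = UQF g p"
proof -
  have "(\<integral>\<theta>. f \<theta> * h \<theta> \<partial>lborel) = (\<integral>\<theta>. g \<theta> * h \<theta> \<partial>lborel)" if [measurable]: "h \<in> borel_measurable borel" for h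
    by (rule integral_cong_AE) (use assms(1) in auto)
  then show ?thesis unfolding UQF_def dvar_def by simp
qed

section \<open>The balanced random-intercept model\<close>

text \<open>Grouping the observations by their pair of levels turns sums over the data into sums
  over cells.\<close>

lemma sum_wcnt:
  fixes D :: "'i::finite \<Rightarrow> real" and la :: "'i \<Rightarrow> 'a::finite" and lb :: "'i \<Rightarrow> 'b::finite"
  shows "(\<Sum>i\<in>UNIV. (D i)\<^sup>2 * F (la i) (lb i)) = (\<Sum>g\<in>UNIV. \<Sum>h\<in>UNIV. wcnt D la lb g h * F g h)"
proof -
  have "(\<Sum>g\<in>UNIV. \<Sum>h\<in>UNIV. wcnt D la lb g h * F g h)
      = (\<Sum>g\<in>UNIV. \<Sum>h\<in>UNIV. \<Sum>i\<in>UNIV. if la i = g \<and> lb i = h then (D i)\<^sup>2 * F g h else 0)"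
    unfolding wcnt_def sum_distrib_right by (intro sum.cong refl) auto
  also have "\<dots> = (\<Sum>g\<in>UNIV. \<Sum>i\<in>UNIV. \<Sum>h\<in>UNIV. if la i = g \<and> lb i = h then (D i)\<^sup>2 * F g h else 0)"
    by (intro sum.cong refl sum.swap)
  also have "\<dots> = (\<Sum>i\<in>UNIV. \<Sum>g\<in>UNIV. \<Sum>h\<in>UNIV. if la i = g \<and> lb i = h then (D i)\<^sup>2 * F g h else 0)"
    by (rule sum.swap)
  also have "\<dots> = (\<Sum>i\<in>UNIV. (D i)\<^sup>2 * F (la i) (lb i))"
  proof (intro sum.cong refl)
    fix i
    have "(\<Sum>h\<in>UNIV. if la i = g \<and> lb i = h then (D i)\<^sup>2 * F g h else 0)
        = (if la i = g then (D i)\<^sup>2 * F g (lb i) else 0)" for g by simp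
    then show "(\<Sum>g\<in>UNIV. \<Sum>h\<in>UNIV. if la i = g \<and> lb i = h then (D i)\<^sup>2 * F g h else 0)
        = (D i)\<^sup>2 * F (la i) (lb i)" by simp
  qed
  finally show ?thesis ..
qed

lemma wcnt_commute: "wcnt D la lb g h = wcnt D lb la h g"
  by (simp add: wcnt_def conj_commute)

lemma wcnt_diag: "g \<noteq> h \<Longrightarrow> wcnt D la la g h = 0"
  unfolding wcnt_def by (intro sum.neutral) auto

lemma sum_wcnt_diag:
  fixes D :: "'i::finite \<Rightarrow> real" and la :: "'i \<Rightarrow> 'a::finite"
  shows "(\<Sum>i\<in>UNIV. (D i)\<^sup>2 * F (la i)) = (\<Sum>g\<in>UNIV. wcnt D la la g g * F g)"
proof -
  have "(\<Sum>h\<in>UNIV. wcnt D la la g h * F g) = wcnt D la la g g * F g" for g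
    by (subst sum.remove[of _ g]) (auto simp: wcnt_diag)
  then show ?thesis using sum_wcnt[of D "\<lambda>g h. F g" la la] by simp
qed

text \<open>Split \<open>x\<close> into its mean and its deviation from it. The deviation carries
  the factor \<open>n + T\<close>, and the mean part contributes
  \<open>T / G * (x \<bullet> 1)\<^sup>2\<close>. Here \<open>n\<close> is the common weighted level
  count, and the operator is what remains of a block once the intercept is eliminated.\<close>

lemma spd_scaled_identity_minus_mean:
  fixes n N T :: real
  assumes "T > 0" "n > 0" "real CARD('g::finite) * n = N"
  shows "spd (\<lambda>x::real^'g. (n + T) *\<^sub>R x - (n\<^sup>2 / N * (x \<bullet> 1)) *\<^sub>R 1)"
    and "x \<bullet> ((n + T) *\<^sub>R x - (n\<^sup>2 / N * (x \<bullet> 1)) *\<^sub>R (1::real^'g))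
      \<ge> (n + T) * (norm (x - ((x \<bullet> 1) / real CARD('g)) *\<^sub>R 1))\<^sup>2"
proof -
  define G where "G = real CARD('g)"
  have G: "G > 0" by (simp add: G_def)
  have N: "N = G * n" using assms by (simp add: G_def)
  have one: "(1::real^'g) \<bullet> 1 = G" by (simp add: inner_vec_def G_def)
  have perp: "(norm (x - ((x \<bullet> 1) / G) *\<^sub>R 1))\<^sup>2 = x \<bullet> x - (x \<bullet> 1)\<^sup>2 / G" for x :: "real^'g"
    unfolding power2_norm_eq_inner using G one
    by (simp add: inner_diff inner_commute power2_eq_square field_simps)
  have form: "x \<bullet> ((n + T) *\<^sub>R x - (n\<^sup>2 / N * (x \<bullet> 1)) *\<^sub>R 1)
      = (n + T) * (norm (x - ((x \<bullet> 1) / G) *\<^sub>R 1))\<^sup>2 + T / G * (x \<bullet> 1)\<^sup>2" for x :: "real^'g"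
    unfolding perp inner_diff_right inner_scaleR_right using G assms(2)
    by (simp add: N power2_eq_square field_simps)
  show "x \<bullet> ((n + T) *\<^sub>R x - (n\<^sup>2 / N * (x \<bullet> 1)) *\<^sub>R (1::real^'g))
      \<ge> (n + T) * (norm (x - ((x \<bullet> 1) / real CARD('g)) *\<^sub>R 1))\<^sup>2"
    using form[of x] G assms(1) by (simp add: G_def)
  show "spd (\<lambda>x::real^'g. (n + T) *\<^sub>R x - (n\<^sup>2 / N * (x \<bullet> 1)) *\<^sub>R 1)"
  proof (rule spd.intro)
    show "linear (\<lambda>x::real^'g. (n + T) *\<^sub>R x - (n\<^sup>2 / N * (x \<bullet> 1)) *\<^sub>R 1)"
      by (rule linearI) (simp_all add: algebra_simps inner_add add_divide_distrib)
    fix x y :: "real^'g"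
    show "((n + T) *\<^sub>R x - (n\<^sup>2 / N * (x \<bullet> 1)) *\<^sub>R 1) \<bullet> y = x \<bullet> ((n + T) *\<^sub>R y - (n\<^sup>2 / N * (y \<bullet> 1)) *\<^sub>R 1)"
      by (simp add: inner_diff inner_commute)
    assume "x \<noteq> 0"
    show "0 < x \<bullet> ((n + T) *\<^sub>R x - (n\<^sup>2 / N * (x \<bullet> 1)) *\<^sub>R 1)"
    proof (cases "x \<bullet> 1 = 0")
      case True
      then show ?thesis using \<open>x \<noteq> 0\<close> assms by simp
    next
      case False
      then have "0 < T / G * (x \<bullet> 1)\<^sup>2" using G assms by simp
      moreover have "0 \<le> (n + T) * (norm (x - ((x \<bullet> 1) / G) *\<^sub>R 1))\<^sup>2" using assms by simp
      ultimately show ?thesis unfolding form by linarith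
    qed
  qed
qed

section \<open>Precision operators of the balanced model\<close>

locale balanced_model =
  fixes D \<nu> :: "'i::finite \<Rightarrow> real"
    and l1 :: "'i \<Rightarrow> 'g1::finite" and l2 :: "'i \<Rightarrow> 'g2::finite"
    and T1 T2 n1 n2 :: real
  assumes T1: "T1 > 0" and T2: "T2 > 0" and n1: "n1 > 0" and n2: "n2 > 0"
    and bal1: "\<And>g. wcnt D l1 l1 g g = n1" and bal2: "\<And>g. wcnt D l2 l2 g g = n2"
begin

definition N :: real where "N = (\<Sum>i\<in>UNIV. (D i)\<^sup>2)"

definition W :: "real^'g2^'g1" where "W = (\<chi> g h. wcnt D l1 l2 g h)"

text \<open>A constant of its own, since the simplifier rewrites \<open>transpose W *v x\<close> to \<open>x v* W\<close>.\<close>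

definition Wt :: "real^'g1^'g2" where "Wt = transpose W"

text \<open>The cell weight of a perfectly proportional design with these margins, and also the
  coefficient of the cross term in the completed square of \<open>form_R\<close>.\<close>

definition k :: real where "k = n1 * n2 / N"

text \<open>Precision operators of the target and of the optimal approximation; under balancedness they
  differ only in the coupling of the two blocks.\<close>

definition Q :: "('g1, 'g2) par \<Rightarrow> ('g1, 'g2) par" where
  "Q = (\<lambda>(t, x, y). (N * t + n1 * (x \<bullet> 1) + n2 * (y \<bullet> 1),
     (n1 * t) *\<^sub>R 1 + (n1 + T1) *\<^sub>R x + W *v y,
     (n2 * t) *\<^sub>R 1 + Wt *v x + (n2 + T2) *\<^sub>R y))"

definition R :: "('g1, 'g2) par \<Rightarrow> ('g1, 'g2) par" where
  "R = (\<lambda>(t, x, y). (N * t + n1 * (x \<bullet> 1) + n2 * (y \<bullet> 1),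
     (n1 * t) *\<^sub>R 1 + (n1 + T1) *\<^sub>R x + (k * (y \<bullet> 1)) *\<^sub>R 1,
     (n2 * t) *\<^sub>R 1 + (k * (x \<bullet> 1)) *\<^sub>R 1 + (n2 + T2) *\<^sub>R y))"

text \<open>The deviation of the cell weights from the proportional design. Both have the same
  margins, so \<open>B\<close> annihilates constant vectors.\<close>

definition B :: "real^'g2 \<Rightarrow> real^'g1" where "B y = W *v y - (k * (y \<bullet> 1)) *\<^sub>R 1"

lemma adj: "(Wt *v x) \<bullet> y = x \<bullet> (W *v y)"
  by (simp add: Wt_def dot_lmul_matrix)

lemma sum_x: "(\<Sum>i\<in>UNIV. (D i)\<^sup>2 * x $ l1 i) = n1 * (x \<bullet> 1)"
  by (simp add: sum_wcnt_diag[of D "\<lambda>g. x $ g"] bal1 inner_vec_def sum_distrib_left)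

lemma sum_y: "(\<Sum>i\<in>UNIV. (D i)\<^sup>2 * y $ l2 i) = n2 * (y \<bullet> 1)"
  by (simp add: sum_wcnt_diag[of D "\<lambda>g. y $ g"] bal2 inner_vec_def sum_distrib_left)

lemma sum_xx: "(\<Sum>i\<in>UNIV. (D i)\<^sup>2 * (x $ l1 i)\<^sup>2) = n1 * (x \<bullet> x)"
  unfolding sum_wcnt_diag[of D "\<lambda>g. (x $ g)\<^sup>2"]
  by (simp add: bal1 inner_vec_def sum_distrib_left power2_eq_square)

lemma sum_yy: "(\<Sum>i\<in>UNIV. (D i)\<^sup>2 * (y $ l2 i)\<^sup>2) = n2 * (y \<bullet> y)"
  unfolding sum_wcnt_diag[of D "\<lambda>g. (y $ g)\<^sup>2"]
  by (simp add: bal2 inner_vec_def sum_distrib_left power2_eq_square)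

lemma sum_xy: "(\<Sum>i\<in>UNIV. (D i)\<^sup>2 * (x $ l1 i * y $ l2 i)) = x \<bullet> (W *v y)"
  unfolding sum_wcnt[of D "\<lambda>g h. x $ g * y $ h"]
  by (simp add: W_def inner_vec_def matrix_vector_mult_def sum_distrib_left mult_ac)

lemma N1: "real CARD('g1) * n1 = N"
  using sum_wcnt_diag[of D "\<lambda>_. 1" l1] by (simp add: bal1 N_def)

lemma N2: "real CARD('g2) * n2 = N"
  using sum_wcnt_diag[of D "\<lambda>_. 1" l2] by (simp add: bal2 N_def)

lemma N_pos: "N > 0"
  using N1 n1 by (metis mult_pos_pos of_nat_0_less_iff zero_less_card_finite)

lemma inner_one [simp]: "(1::real^'g1) \<bullet> 1 = real CARD('g1)" "(1::real^'g2) \<bullet> 1 = real CARD('g2)"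
  by (simp_all add: inner_vec_def)

text \<open>Each observation has exactly one level of the second factor, so the row sums of
  \<open>W\<close> are the level counts of the first.\<close>

lemma W_one: "W *v 1 = n1 *\<^sub>R 1"
proof -
  have "x \<bullet> (W *v 1) = x \<bullet> (n1 *\<^sub>R 1)" for x
    using sum_xy[of x 1] sum_x[of x] by simp
  then show ?thesis using vector_eq_ldot by blast
qed

lemma Wt_one: "Wt *v 1 = n2 *\<^sub>R 1"
proof -
  have "y \<bullet> (Wt *v 1) = y \<bullet> (n2 *\<^sub>R 1)" for y
    using sum_xy[of 1 y] sum_y[of y] adj[of 1 y] by (simp add: inner_commute)
  then show ?thesis using vector_eq_ldot by blast
qed

lemma form_Q: "(t, x, y) \<bullet> Q (t, x, y)
    = (\<Sum>i\<in>UNIV. (D i)\<^sup>2 * (eta l1 l2 (t, x, y) i)\<^sup>2) + T1 * (x \<bullet> x) + T2 * (y \<bullet> y)"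
proof -
  have "(D i)\<^sup>2 * (eta l1 l2 (t, x, y) i)\<^sup>2 = t\<^sup>2 * (D i)\<^sup>2 + 2 * t * ((D i)\<^sup>2 * x $ l1 i) + 2 * t * ((D i)\<^sup>2 * y $ l2 i)
      + (D i)\<^sup>2 * (x $ l1 i)\<^sup>2 + (D i)\<^sup>2 * (y $ l2 i)\<^sup>2 + 2 * ((D i)\<^sup>2 * (x $ l1 i * y $ l2 i))" for i
    by (simp add: eta_def power2_eq_square algebra_simps)
  then have "(\<Sum>i\<in>UNIV. (D i)\<^sup>2 * (eta l1 l2 (t, x, y) i)\<^sup>2) = t\<^sup>2 * N + 2 * t * (n1 * (x \<bullet> 1))
      + 2 * t * (n2 * (y \<bullet> 1)) + n1 * (x \<bullet> x) + n2 * (y \<bullet> y) + 2 * (x \<bullet> (W *v y))"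
    by (simp only: sum.distrib sum_distrib_left[symmetric] sum_x sum_y sum_xx sum_yy sum_xy N_def)
  moreover have "y \<bullet> (Wt *v x) = x \<bullet> (W *v y)" using adj[of x y] by (simp add: inner_commute)
  ultimately show ?thesis
    by (simp add: Q_def inner_add_right power2_eq_square) (simp add: algebra_simps inner_commute)
qed

lemma form_Q_R: "\<theta> \<bullet> Q \<theta> = \<theta> \<bullet> R \<theta> + 2 * (fst (snd \<theta>) \<bullet> B (snd (snd \<theta>)))"
proof -
  obtain t x y where \<theta>: "\<theta> = (t, x, y)" by (cases \<theta>) auto
  have "y \<bullet> (Wt *v x) = x \<bullet> (W *v y)" using adj[of x y] by (simp add: inner_commute)
  then show ?thesis
    by (simp add: \<theta> Q_def R_def B_def inner_add_right inner_diff_right)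
qed

definition A1 :: "real^'g1 \<Rightarrow> real^'g1" where "A1 x = (n1 + T1) *\<^sub>R x - (n1\<^sup>2 / N * (x \<bullet> 1)) *\<^sub>R 1"
definition A2 :: "real^'g2 \<Rightarrow> real^'g2" where "A2 y = (n2 + T2) *\<^sub>R y - (n2\<^sup>2 / N * (y \<bullet> 1)) *\<^sub>R 1"

text \<open>Completing the square in the intercept. The value of \<open>k\<close> makes the square
  absorb the whole coupling of \<open>x\<close> and \<open>y\<close>, which gives the shape required
  by \<open>pf_family_gauss\<close>.\<close>

lemma form_R: "(t, x, y) \<bullet> R (t, x, y)
    = N * (t + x \<bullet> ((n1 / N) *\<^sub>R 1) + y \<bullet> ((n2 / N) *\<^sub>R 1))\<^sup>2 + x \<bullet> A1 x + y \<bullet> A2 y"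
  using N_pos by (simp add: R_def A1_def A2_def k_def inner_add_right inner_diff_right power2_eq_square)
    (simp add: field_simps)

lemma spd_A1: "spd A1" and spd_A2: "spd A2"
  unfolding A1_def[abs_def] A2_def[abs_def]
  using spd_scaled_identity_minus_mean(1) T1 T2 n1 n2 N1 N2 by blast+

lemma spd_R: "spd R"
proof (rule spd.intro)
  show "linear R"
    by (rule linearI) (auto simp: R_def inner_add_left algebra_simps)
  show "R \<theta> \<bullet> \<theta>' = \<theta> \<bullet> R \<theta>'" for \<theta> \<theta>'
    by (cases \<theta>; cases \<theta>') (simp add: R_def inner_add_left inner_add_right inner_commute algebra_simps)
  fix \<theta> :: "('g1, 'g2) par" assume nz: "\<theta> \<noteq> 0"
  obtain t x y where \<theta>: "\<theta> = (t, x, y)" by (cases \<theta>) auto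
  have xy: "0 \<le> x \<bullet> A1 x" "0 \<le> y \<bullet> A2 y" "x \<noteq> 0 \<Longrightarrow> 0 < x \<bullet> A1 x" "y \<noteq> 0 \<Longrightarrow> 0 < y \<bullet> A2 y"
    using spd_A1 spd_A2 by (auto intro: spd.nonneg spd.pos)
  show "0 < \<theta> \<bullet> R \<theta>"
  proof (cases "x = 0 \<and> y = 0")
    case True
    then show ?thesis using nz N_pos xy by (simp add: \<theta> form_R zero_prod_def)
  next
    case False
    have "0 \<le> N * (t + x \<bullet> ((n1 / N) *\<^sub>R 1) + y \<bullet> ((n2 / N) *\<^sub>R 1))\<^sup>2" using N_pos by simp
    then show ?thesis unfolding \<theta> form_R using False xy by linarith
  qed
qed

lemma spd_Q: "spd Q"
proof (rule spd.intro)
  show "linear Q"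
    by (rule linearI) (auto simp: Q_def inner_add_left algebra_simps matrix_vector_right_distrib
      matrix_vector_mult_scaleR)
  show "Q \<theta> \<bullet> \<theta>' = \<theta> \<bullet> Q \<theta>'" for \<theta> \<theta>'
  proof -
    obtain t x y where \<theta>: "\<theta> = (t, x, y)" by (cases \<theta>) auto
    obtain t' x' y' where \<theta>': "\<theta>' = (t', x', y')" by (cases \<theta>') auto
    show ?thesis
      using adj[of x' y] adj[of x y']
      by (simp add: \<theta> \<theta>' Q_def inner_add_left inner_add_right inner_commute algebra_simps)
  qed
  fix \<theta> :: "('g1, 'g2) par" assume nz: "\<theta> \<noteq> 0"
  obtain t x y where \<theta>: "\<theta> = (t, x, y)" by (cases \<theta>) auto
  show "0 < \<theta> \<bullet> Q \<theta>"
  proof (cases "x = 0 \<and> y = 0")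
    case True
    then show ?thesis using nz N_pos by (simp add: \<theta> Q_def zero_prod_def mult.left_commute[of t] flip: power2_eq_square)
  next
    case False
    have "0 \<le> (\<Sum>i\<in>UNIV. (D i)\<^sup>2 * (eta l1 l2 (t, x, y) i)\<^sup>2)" by (intro sum_nonneg) simp
    moreover have "0 < T1 * (x \<bullet> x) + T2 * (y \<bullet> y)"
      using False T1 T2 by (auto intro: add_pos_nonneg add_nonneg_pos)
    ultimately show ?thesis unfolding \<theta> form_Q by linarith
  qed
qed

text \<open>Completing the square in the energy; the constant factor \<open>K\<close> cancels
  against the normaliser.\<close>

lemma pi_dens_eq_gauss: "\<exists>\<mu>. pi_dens D \<nu> T1 T2 l1 l2 = gauss Q \<mu>"
proof -
  interpret Q: spd Q by (rule spd_Q)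
  \<comment> \<open>The linear part of the energy is \<open>- 2 * (\<theta> \<bullet> s)\<close>, so
    the mean solves \<open>Q \<mu> = s\<close>.\<close>
  define s :: "('g1, 'g2) par" where "s = (\<Sum>i\<in>UNIV. (D i * \<nu> i) *\<^sub>R (1, axis (l1 i) 1, axis (l2 i) 1))"
  obtain \<mu> where \<mu>: "Q \<mu> = s" by (rule Q.surjE)
  define K where "K = exp (- ((\<Sum>i\<in>UNIV. (\<nu> i)\<^sup>2) - \<mu> \<bullet> Q \<mu>) / 2)"
  have E: "energy D \<nu> T1 T2 l1 l2 \<theta> = (\<theta> - \<mu>) \<bullet> Q (\<theta> - \<mu>) + ((\<Sum>i\<in>UNIV. (\<nu> i)\<^sup>2) - \<mu> \<bullet> Q \<mu>)" for \<theta>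
  proof -
    obtain t x y where \<theta>: "\<theta> = (t, x, y)" by (cases \<theta>) auto
    have s: "\<theta> \<bullet> s = (\<Sum>i\<in>UNIV. D i * \<nu> i * eta l1 l2 \<theta> i)"
      by (simp add: s_def inner_sum_right \<theta> eta_def inner_axis algebra_simps)
    have "(\<nu> i - D i * eta l1 l2 \<theta> i)\<^sup>2 = (\<nu> i)\<^sup>2 - 2 * (D i * \<nu> i * eta l1 l2 \<theta> i)
        + (D i)\<^sup>2 * (eta l1 l2 \<theta> i)\<^sup>2" for i
      by (simp add: power2_eq_square algebra_simps)
    then have "(\<Sum>i\<in>UNIV. (\<nu> i - D i * eta l1 l2 \<theta> i)\<^sup>2) = (\<Sum>i\<in>UNIV. (\<nu> i)\<^sup>2) - 2 * (\<theta> \<bullet> s)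
        + (\<Sum>i\<in>UNIV. (D i)\<^sup>2 * (eta l1 l2 \<theta> i)\<^sup>2)"
      unfolding s by (simp add: sum.distrib sum_subtractf sum_distrib_left)
    then show ?thesis
      unfolding energy_def Q.form_diff \<mu> using form_Q[of t x y] by (simp add: \<theta> power2_norm_eq_inner)
  qed
  have expE: "exp (- energy D \<nu> T1 T2 l1 l2 \<theta> / 2) = exp (- ((\<theta> - \<mu>) \<bullet> Q (\<theta> - \<mu>)) / 2) * K" for \<theta>
    unfolding E K_def by (simp add: diff_divide_distrib add_divide_distrib flip: exp_add)
  have "pi_dens D \<nu> T1 T2 l1 l2 \<theta> = gauss Q \<mu> \<theta>" for \<theta>
    unfolding pi_dens_def expE gauss_def
    using lborel_integral_shift[of "\<lambda>\<theta>. exp (- (\<theta> \<bullet> Q \<theta>) / 2)" \<mu>] by (simp add: K_def)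
  then show ?thesis by blast
qed

section \<open>The stochastic matrix and the correlation of the blocks\<close>

definition M :: "real^'g1^'g1" where "M = Smat D l1 l2 ** Smat D l2 l1"

text \<open>Balancedness makes the row normalisations scalars, so the stochastic matrix becomes a
  multiple of \<open>W\<close> times its transpose. Symmetry and positivity follow from this
  form.\<close>

lemma M_eq: "M *v x = (1 / (n1 * n2)) *\<^sub>R (W *v (Wt *v x))"
proof -
  have S: "Smat D l1 l2 = (1 / n1) *\<^sub>R W" "Smat D l2 l1 = (1 / n2) *\<^sub>R Wt"
    by (simp_all add: Smat_def W_def Wt_def transpose_def bal1 bal2 vec_eq_iff wcnt_commute[of D l2 l1])
  have "M *v x = ((1 / n1) *\<^sub>R W) *v (((1 / n2) *\<^sub>R Wt) *v x)"
    by (simp only: M_def S matrix_vector_mul_assoc)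
  also have "\<dots> = (1 / n2) *\<^sub>R (1 / n1) *\<^sub>R (W *v (Wt *v x))"
    by (simp only: scaleR_matrix_vector_assoc[symmetric] matrix_vector_mult_scaleR)
  finally show ?thesis by (simp add: mult.commute)
qed

lemma form_M: "x \<bullet> (M *v x) = (norm (Wt *v x))\<^sup>2 / (n1 * n2)"
  unfolding M_eq power2_norm_eq_inner adj by simp

text \<open>\<open>y / n2\<close> averages \<open>x\<close> over each level of the second factor,
  and the weighted residual sum of squares about these averages is nonnegative; scaling by
  \<open>n2\<close> clears the denominators.\<close>

lemma M_contraction: "x \<bullet> (M *v x) \<le> x \<bullet> x"
proof -
  define y where "y = Wt *v x"
  have xy: "x \<bullet> (W *v y) = y \<bullet> y" using adj[of x y] by (simp add: y_def)
  have "0 \<le> (\<Sum>i\<in>UNIV. (D i)\<^sup>2 * (n2 * x $ l1 i - y $ l2 i)\<^sup>2)" by (intro sum_nonneg) simp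
  also have "\<dots> = n2\<^sup>2 * (n1 * (x \<bullet> x)) - 2 * n2 * (x \<bullet> (W *v y)) + n2 * (y \<bullet> y)"
  proof -
    have "(D i)\<^sup>2 * (n2 * x $ l1 i - y $ l2 i)\<^sup>2 = n2\<^sup>2 * ((D i)\<^sup>2 * (x $ l1 i)\<^sup>2)
        - 2 * n2 * ((D i)\<^sup>2 * (x $ l1 i * y $ l2 i)) + (D i)\<^sup>2 * (y $ l2 i)\<^sup>2" for i
      by (simp add: power2_eq_square algebra_simps)
    then show ?thesis
      by (simp only: sum.distrib sum_subtractf sum_distrib_left[symmetric] sum_xx sum_yy sum_xy)
  qed
  also have "\<dots> = n2 * (n1 * n2 * (x \<bullet> x) - y \<bullet> y)"
    unfolding xy by (simp add: power2_eq_square algebra_simps)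
  finally have "y \<bullet> y \<le> n1 * n2 * (x \<bullet> x)" using n2 by (simp add: zero_le_mult_iff)
  then show ?thesis
    unfolding form_M power2_norm_eq_inner using n1 n2 by (simp add: y_def field_simps)
qed

lemma transpose_M: "transpose M = M"
proof -
  have "x \<bullet> (transpose M *v y) = x \<bullet> (M *v y)" for x y
  proof -
    have "x \<bullet> (transpose M *v y) = (M *v x) \<bullet> y"
      by (metis dot_lmul_matrix inner_commute transpose_matrix_vector)
    also have "\<dots> = (1 / (n1 * n2)) * ((W *v (Wt *v x)) \<bullet> y)" by (simp add: M_eq)
    also have "(W *v (Wt *v x)) \<bullet> y = x \<bullet> (W *v (Wt *v y))"
      using adj[of y "Wt *v x"] adj[of x "Wt *v y"] by (simp add: inner_commute)
    finally show ?thesis by (simp add: M_eq)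
  qed
  then have "transpose M *v y = M *v y" for y using vector_eq_ldot by blast
  then show ?thesis unfolding matrix_eq by blast
qed

definition lam :: real where "lam = second_mod_eig M"

lemma lam_props:
  shows "0 \<le> lam"
    and "x \<bullet> 1 = 0 \<Longrightarrow> x \<bullet> (M *v x) \<le> lam * (x \<bullet> x)"
    and "lam = 0 \<or> (\<exists>x. x \<noteq> 0 \<and> x \<bullet> 1 = 0 \<and> M *v x = lam *\<^sub>R x)"
proof -
  have one: "M *v 1 = 1"
    using n1 n2 by (simp add: M_eq Wt_one W_one matrix_vector_mult_scaleR)
  have psd: "0 \<le> x \<bullet> (M *v x)" for x unfolding form_M using n1 n2 by simp
  note * = second_mod_eig_doubly_stochastic_psd[OF transpose_M one psd M_contraction, folded lam_def]
  show "0 \<le> lam" "x \<bullet> 1 = 0 \<Longrightarrow> x \<bullet> (M *v x) \<le> lam * (x \<bullet> x)"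
    "lam = 0 \<or> (\<exists>x. x \<noteq> 0 \<and> x \<bullet> 1 = 0 \<and> M *v x = lam *\<^sub>R x)"
    by (fact *)+
qed

text \<open>The correlation of the two blocks once the intercept is eliminated; the claimed
  quadratic factor is \<open>1 - rho\<close>.\<close>

definition rho :: real where "rho = sqrt (n1 * n2 * lam / ((n1 + T1) * (n2 + T2)))"

lemma rho_nonneg: "0 \<le> rho"
  unfolding rho_def using lam_props(1) n1 n2 T1 T2 by simp

lemma rho_sq: "rho\<^sup>2 * ((n1 + T1) * (n2 + T2)) = n1 * n2 * lam"
  unfolding rho_def using lam_props(1) n1 n2 T1 T2 by simp

text \<open>\<open>B\<close> sees only the centred parts of \<open>x\<close> and \<open>y\<close>.
  On centred vectors \<open>lam\<close> bounds the form of \<open>M\<close>, hence the norm of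
  \<open>Wt *v x'\<close>; Cauchy-Schwarz and then the arithmetic-geometric mean inequality with
  weights \<open>sqrt a\<close> and \<open>sqrt b\<close> give the two block forms.\<close>

lemma cross_bound: "2 * \<bar>x \<bullet> B y\<bar> \<le> rho * (x \<bullet> A1 x + y \<bullet> A2 y)"
proof -
  define x' where "x' = x - ((x \<bullet> 1) / real CARD('g1)) *\<^sub>R 1"
  define y' where "y' = y - ((y \<bullet> 1) / real CARD('g2)) *\<^sub>R 1"
  define a b where "a = n1 + T1" and "b = n2 + T2"
  have ab: "a > 0" "b > 0" using n1 n2 T1 T2 by (auto simp: a_def b_def)
  have x'1: "x' \<bullet> 1 = 0" by (simp add: x'_def inner_diff_left)
  have "x \<bullet> B y = x' \<bullet> (W *v y')"
  proof -
    have "(1::real^'g1) \<bullet> (W *v y) = n2 * (y \<bullet> 1)"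
      using adj[of 1 y] by (simp add: Wt_one inner_commute)
    moreover have "x' \<bullet> (W *v y') = x' \<bullet> (W *v y)"
      by (simp add: y'_def matrix_vector_mult_diff_distrib matrix_vector_mult_scaleR W_one inner_diff_right x'1)
    moreover have "n2 / real CARD('g1) = k"
      using N_pos n1 N1 by (simp add: k_def field_simps)
    ultimately show ?thesis
      by (simp add: B_def x'_def inner_diff_left inner_diff_right) (simp add: field_simps)
  qed
  then have "\<bar>x \<bullet> B y\<bar> \<le> norm (Wt *v x') * norm y'"
    unfolding adj[symmetric] by (simp only: Cauchy_Schwarz_ineq2)
  also have "norm (Wt *v x') \<le> sqrt (n1 * n2 * lam) * norm x'"
  proof (rule power2_le_imp_le)
    have "(norm (Wt *v x'))\<^sup>2 \<le> n1 * n2 * lam * (norm x')\<^sup>2"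
      using lam_props(2)[OF x'1] n1 n2 unfolding form_M by (simp add: field_simps power2_norm_eq_inner)
    also have "\<dots> = (sqrt (n1 * n2 * lam) * norm x')\<^sup>2"
      using n1 n2 lam_props(1) by (simp add: power_mult_distrib)
    finally show "(norm (Wt *v x'))\<^sup>2 \<le> (sqrt (n1 * n2 * lam) * norm x')\<^sup>2" .
  qed (use n1 n2 lam_props(1) in auto)
  also have "sqrt (n1 * n2 * lam) = rho * (sqrt a * sqrt b)"
    using rho_nonneg ab by (simp add: a_def b_def real_sqrt_mult flip: rho_sq)
  finally have "2 * \<bar>x \<bullet> B y\<bar> \<le> rho * (2 * (sqrt a * norm x') * (sqrt b * norm y'))"
    by (simp add: mult_right_mono mult_ac)
  also have "\<dots> \<le> rho * ((sqrt a * norm x')\<^sup>2 + (sqrt b * norm y')\<^sup>2)"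
    by (intro mult_left_mono rho_nonneg sum_squares_bound)
  also have "\<dots> = rho * (a * (norm x')\<^sup>2 + b * (norm y')\<^sup>2)"
    using ab by (simp add: power_mult_distrib)
  also have "\<dots> \<le> rho * (x \<bullet> A1 x + y \<bullet> A2 y)"
    unfolding a_def b_def x'_def y'_def A1_def A2_def
    by (intro mult_left_mono add_mono rho_nonneg spd_scaled_identity_minus_mean(2) T1 T2 n1 n2 N1 N2)
  finally show ?thesis .
qed

lemma form_ratio: "(1 - rho) * (\<theta> \<bullet> R \<theta>) \<le> \<theta> \<bullet> Q \<theta>"
proof -
  obtain t x y where \<theta>: "\<theta> = (t, x, y)" by (cases \<theta>) auto
  have "rho * (x \<bullet> A1 x + y \<bullet> A2 y) \<le> rho * (\<theta> \<bullet> R \<theta>)"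
    unfolding \<theta> form_R using N_pos by (intro mult_left_mono rho_nonneg) simp
  then show ?thesis
    using cross_bound[of x y] by (simp add: form_Q_R \<theta> left_diff_distrib)
qed

text \<open>Equality in \<open>cross_bound\<close> calls for a centred eigenvector \<open>x\<close>
  of \<open>M\<close> for \<open>lam\<close>, with \<open>y\<close> parallel to its image under
  \<open>Wt\<close>.\<close>

lemma form_ratio_attained: "\<exists>u. u \<noteq> 0 \<and> Q u = (1 - rho) *\<^sub>R R u"
proof (cases "lam = 0")
  case True
  then have "rho = 0" by (simp add: rho_def)
  then show ?thesis
    \<comment> \<open>The bound is then 1, and the two operators agree on the intercept
      direction.\<close>
    by (intro exI[of _ "(1, 0, 0)"]) (simp add: Q_def R_def zero_prod_def)
next
  case False
  then obtain x where x: "x \<noteq> 0" "x \<bullet> 1 = 0" "M *v x = lam *\<^sub>R x"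
    using lam_props(3) by blast
  define a b where "a = n1 + T1" and "b = n2 + T2"
  have ab: "a > 0" "b > 0" using n1 n2 T1 T2 by (auto simp: a_def b_def)
  have rho: "rho \<noteq> 0" using False rho_sq n1 n2 by auto
  \<comment> \<open>The negative sign makes the coupling term negative, and the scale
    \<open>1 / (rho * b)\<close> makes both block equations hold with the same factor
    \<open>1 - rho\<close>.\<close>
  define y where "y = (- 1 / (rho * b)) *\<^sub>R (Wt *v x)"
  have y1: "y \<bullet> 1 = 0" by (simp add: y_def adj W_one x)
  have Wt: "Wt *v x = (- rho * b) *\<^sub>R y" using rho ab by (simp add: y_def)
  have "(n1 * n2) *\<^sub>R (M *v x) = (n1 * n2 * lam) *\<^sub>R x" by (simp add: x(3))
  then have WWt: "W *v (Wt *v x) = (rho\<^sup>2 * (a * b)) *\<^sub>R x"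
    using n1 n2 by (simp add: M_eq a_def b_def rho_sq)
  have "W *v y = (- 1 / (rho * b) * (rho\<^sup>2 * (a * b))) *\<^sub>R x"
    by (simp only: y_def matrix_vector_mult_scaleR WWt scaleR_scaleR)
  also have "- 1 / (rho * b) * (rho\<^sup>2 * (a * b)) = - rho * a"
    using rho ab by (simp add: power2_eq_square)
  finally have Wy: "W *v y = (- rho * a) *\<^sub>R x" .
  have "Q (0, x, y) = (1 - rho) *\<^sub>R R (0, x, y)"
    by (simp add: Q_def R_def x y1 Wt Wy a_def b_def algebra_simps)
  then show ?thesis using x(1) by (intro exI[of _ "(0, x, y)"]) (simp add: zero_prod_def)
qed

lemma linear_B: "linear B"
  by (rule linearI) (simp_all add: B_def inner_add_left matrix_vector_right_distrib
    matrix_vector_mult_scaleR algebra_simps)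

lemma pf_opt:
  shows "\<exists>f. is_pf_opt (pi_dens D \<nu> T1 T2 l1 l2) f"
    and "is_pf_opt (pi_dens D \<nu> T1 T2 l1 l2) f \<Longrightarrow> UQF f (pi_dens D \<nu> T1 T2 l1 l2) = 1 - rho"
proof -
  obtain \<mu> where p: "pi_dens D \<nu> T1 T2 l1 l2 = gauss Q \<mu>" using pi_dens_eq_gauss by blast
  have pf: "pf_family (gauss R \<mu>)"
    by (rule pf_family_gauss[OF spd_R spd_A1 spd_A2 N_pos form_R])
  note opt = is_pf_opt_gauss[OF spd_Q spd_R linear_B form_Q_R pf]
  show "\<exists>f. is_pf_opt (pi_dens D \<nu> T1 T2 l1 l2) f"
    unfolding p using opt(1) by blast
  obtain u where u: "u \<noteq> 0" "Q u = (1 - rho) *\<^sub>R R u" using form_ratio_attained by blast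
  assume f: "is_pf_opt (pi_dens D \<nu> T1 T2 l1 l2) f"
  have "f \<in> borel_measurable borel" using f by (auto simp: is_pf_opt_def pf_family_def)
  then have "UQF f (gauss Q \<mu>) = UQF (gauss R \<mu>) (gauss Q \<mu>)"
    by (intro UQF_cong_AE opt(2) f[unfolded p] spd.measurable_gauss[OF spd_R])
  also have "\<dots> = 1 - rho" by (rule UQF_gauss[OF spd_Q spd_R form_ratio u])
  finally show "UQF f (pi_dens D \<nu> T1 T2 l1 l2) = 1 - rho" by (simp only: p)
qed

end

text \<open>Maximisers are unique only almost everywhere, so the formula is asserted for each of
  them, and existence is asserted so that this is not vacuous.\<close>

theorem theorem3:
  fixes D \<nu> :: "'i::finite \<Rightarrow> real"
    and l1 :: "'i \<Rightarrow> 'g1::finite" and l2 :: "'i \<Rightarrow> 'g2::finite"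
    and T1 T2 :: real
  assumes D_pos: "\<forall>i. D i > 0"
    and T1_pos: "T1 > 0" and T2_pos: "T2 > 0"
    and bal1: "\<forall>g g'. wcnt D l1 l1 g g = wcnt D l1 l1 g' g'" "\<forall>g. wcnt D l1 l1 g g > 0"
    and bal2: "\<forall>g g'. wcnt D l2 l2 g g = wcnt D l2 l2 g' g'" "\<forall>g. wcnt D l2 l2 g g > 0"
  shows "(\<exists>f. is_pf_opt (pi_dens D \<nu> T1 T2 l1 l2) f) \<and>
         (\<forall>f. is_pf_opt (pi_dens D \<nu> T1 T2 l1 l2) f \<longrightarrow>
            (let n = real CARD('i);
                 Dbar = (\<Sum>i\<in>UNIV. (D i)^2) / n;
                 lam = second_mod_eig (Smat D l1 l2 ** Smat D l2 l1)
             in UQF f (pi_dens D \<nu> T1 T2 l1 l2)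
                = 1 - (sqrt (n * Dbar / (real CARD('g1) * T1 + n * Dbar))
                       * sqrt (n * Dbar / (real CARD('g2) * T2 + n * Dbar))) * sqrt lam))"
proof -
  obtain n1 n2 where n: "\<And>g. wcnt D l1 l1 g g = n1" "\<And>g. wcnt D l2 l2 g g = n2"
    using bal1(1) bal2(1) by metis
  then have "n1 > 0" "n2 > 0" using bal1(2) bal2(2) by metis+
  then interpret balanced_model D \<nu> l1 l2 T1 T2 n1 n2
    using n T1_pos T2_pos by unfold_locales auto
  \<comment> \<open>\<open>N\<close> is the number of levels times the common level count, and that
    number cancels. The product \<open>n * Dbar\<close> of the statement is
    \<open>N\<close>.\<close>
  have "N / (real CARD('g1) * T1 + N) = n1 / (n1 + T1)" "N / (real CARD('g2) * T2 + N) = n2 / (n2 + T2)"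
    by (simp_all add: distrib_left[symmetric] add.commute flip: N1, simp add: distrib_left[symmetric] add.commute N1 flip: N2)
  then have "sqrt (N / (real CARD('g1) * T1 + N)) * sqrt (N / (real CARD('g2) * T2 + N)) * sqrt lam = rho"
    by (simp add: rho_def flip: real_sqrt_mult)
  then show ?thesis
    using pf_opt by (simp add: Let_def N_def lam_def M_def)
qed

end
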